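(* Let $\mathbb{H},\mathbb{G},\mathbb{F}=\mathbb{H}\times\mathbb{G}$, $f,g,h,A$, the parameters $\eta,\gamma$, the matrix $M$, the operator $\mathcal{T}_{\mathrm{CV}}$, and Algorithms 1 and 2 be as in the context. Let $Z^*$ be the set of solutions to the problem $$\min_{x\in\mathbb{H}} f(x)+g(x)+h(Ax)$$ (understood as a subset of $\mathbb{F}$, as in the context), and let $(z^k)_{k\ge0}\subset\mathbb{F}$ be the sequence generated by Algorithm 1 or Algorithm 2 under the following conditions: (i) $f,g,h^*$ are closed proper convex functions, $f$ is differentiable, and $\nabla f$ is Lipschitz continuous with constant $\beta$; (ii) the delay for every coordinate is bounded by a positive number $\tau$, i.e. for every $1\le i\le m+p$, $\hat z^k_i=z_i^{k-d_i^k}$ for some $0\le d_i^k\le\tau$; (iii) $\eta_k\in[\eta_{\min},\eta_{\max}]$ for certain $\eta_{\min},\eta_{\max}>0$. Explicitly, for Algorithm 2: $$0<\eta_{\max}<\frac{m\,q_{\min}}{2\tau\sqrt{\kappa q_{\min}}+\kappa}\quad\text{and any}\quad 0<\eta_{\min}\le\eta_{\max},$$ where $q_{\min}=\min_i q_i$ and $\kappa=\lambda_{\max}(M)/\lambda_{\min}(M)$ is the condition number of $M$; for Algorithm 1, the same with $m$ replaced by $m+p$. Then $(z^k)_{k\ge0}$ converges to a $Z^*$-valued random variable with probability 1.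
   Context: Setting. $\mathbb{H}=\mathbb{H}_1\times\cdots\times\mathbb{H}_m$ and $\mathbb{G}=\mathbb{G}_1\times\cdots\times\mathbb{G}_p$ are finite-dimensional real Hilbert spaces; $A:\mathbb{H}\to\mathbb{G}$ is linear with blocks $A_{j,i}:\mathbb{H}_i\to\mathbb{G}_j$; $g$ and $h$ may take the value $+\infty$; $h^*$ is the convex conjugate of $h$. $\mathrm{prox}_{\gamma\phi}(y)=\arg\min_x\{\phi(x)+\frac1{2\gamma}\|x-y\|^2\}$. Write $z=(x,s)\in\mathbb{F}$, with coordinates $z_i=x_i$ for $1\le i\le m$ and $z_i=s_{i-m}$ for $m<i\le m+p$; $[n]=\{1,\dots,n\}$. Operator. For $\eta,\gamma>0$, $\mathcal{T}_{\mathrm{CV}}:\mathbb{F}\to\mathbb{F}$ maps $(x,s)$ to $(x^+,s^+)$, where $s^+=\mathrm{prox}_{\gamma h^*}(s+\gamma Ax)$ and $x^+=\mathrm{prox}_{\eta g}\big(x-\eta(\nabla f(x)+A^\top(2s^+-s))\big)$. Let $M=\begin{bmatrix}\frac1\eta I & A^\top\\ A&\frac1\gamma I\end{bmatrix}$ and $\|z\|_M^2=\langle z,Mz\rangle$. The parameters $\eta,\gamma$ are chosen properly, so that $M\succ0$ and $\mathcal{T}_{\mathrm{CV}}$ is nonexpansive under $\|\cdot\|_M$. $Z^*$ is identified with the fixed-point set of $\mathcal{T}_{\mathrm{CV}}$, i.e. the set of $z=(x,s)$ with $0\in\nabla f(x)+\partial g(x)+A^\top s$ and $Ax\in\partial h^*(s)$.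 Let $\mathcal{S}=\mathcal{I}-\mathcal{T}_{\mathrm{CV}}$. Asynchronous reads. Several agents update $z$ in global memory; the counter $k$ increases by one with every completed update. $z^k$ is the state of $z$ just before the $k$th update is applied, and $\hat z^k$ is the (possibly outdated, possibly inconsistent) vector read by the agent performing the $k$th update. The read model is $\hat z^k=z^k+\sum_{d\in J(k)}(z^d-z^{d+1})$ with $J(k)\subseteq\{k-1,\dots,k-\tau\}$, where $\tau$ is the maximum number of other updates to $z$ during the computation of an update, and $z^k=z^0$ for $k<0$. Algorithm 1. Given $z^0\in\mathbb{F}$ and probabilities $q_1,\dots,q_{m+p}>0$ summing to 1, the $i_k\in[m+p]$ are independent random indices with $\mathrm{Prob}(i_k=i)=q_i$, and $$z^{k+1}_{i_k}=z^k_{i_k}-\tfrac{\eta_k}{(m+p)q_{i_k}}\big(\hat z^k_{i_k}-(\mathcal{T}_{\mathrm{CV}}\hat z^k)_{i_k}\big),\qquad z_i^{k+1}=z_i^k\ \ (i\ne i_k).$$ Algorithm 2 (overlapping blocks). Here $g(x)=\sum_{i=1}^m g_i(x_i)$ and $h^*(s)=\sum_{j=1}^p h_j^*(s_j)$. Let $\mathbb{J}(i)=\{j\in[p]:A_{j,i}\ne0\}$ and $\mathbb{I}(j)=\{i\in[m]:A_{j,i}\ne0\}$, with $\mathbb{I}(j)\ne\emptyset$ for all $j$. Fix $\rho_{i,j}\ge0$ with $\sum_{i\in\mathbb{I}(j)}\rho_{i,j}=1$ for every $j\in[p]$. Given $z^0\in\mathbb{F}$ and probabilities $q_1,\dots,q_m>0$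 summing to 1, the $i_k\in[m]$ are independent random indices with $\mathrm{Prob}(i_k=i)=q_i$, and $$x^{k+1}_{i_k}=x^k_{i_k}-\tfrac{\eta_k}{mq_{i_k}}(\mathcal{S}\hat z^k)_{x_{i_k}},\qquad s_j^{k+1}=s_j^k-\tfrac{\rho_{i_k,j}\,\eta_k}{mq_{i_k}}(\mathcal{S}\hat z^k)_{s_j}\ \ (j\in\mathbb{J}(i_k)),$$ with all other coordinates unchanged; $(\cdot)_{x_i}$ and $(\cdot)_{s_j}$ denote the $x_i$- and $s_j$-components.
   Formalization: Z* is assumed nonempty; without this the claim fails (f=0, h=0, A=0, g(x)=x has no solutions). Independence of the random indices is read as: each i_k is independent of the earlier indices and of all reads up to step k, which is automatic for deterministic delays. *)

theory Defs
  imports "HOL-Analysis.Analysis" "HOL-Probability.Probability"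
begin

section \<open>Products of Hilbert spaces and their coordinates\<close>

text \<open>
  The space \<open>V 1 \<times> \<dots> \<times> V n\<close> is rendered coordinate-free, as a Euclidean space that is the orthogonal
  direct sum of subspaces \<open>V 1, \<dots>, V n\<close> (whose dimensions may differ, and may be zero).
  The \<open>i\<close>-th coordinate of \<open>x\<close> is its \<open>V i\<close>-component.
\<close>

definition hilbert_product :: "nat \<Rightarrow> (nat \<Rightarrow> 'a::euclidean_space set) \<Rightarrow> bool" where
  "hilbert_product n V \<longleftrightarrow>
     (\<forall>i\<in>{1..n}. subspace (V i)) \<and>
     (\<forall>i\<in>{1..n}. \<forall>l\<in>{1..n}. i \<noteq> l \<longrightarrow> (\<forall>u\<in>V i. \<forall>v\<in>V l. orthogonal u v)) \<and>
     span (\<Union>i\<in>{1..n}. V i) = UNIV"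

definition coord :: "nat \<Rightarrow> (nat \<Rightarrow> 'a::euclidean_space set) \<Rightarrow> nat \<Rightarrow> 'a \<Rightarrow> 'a" where
  "coord n V i x = (THE y. \<exists>u. (\<forall>l\<in>{1..n}. u l \<in> V l) \<and> x = (\<Sum>l=1..n. u l) \<and> y = u i)"

text \<open>
  Coordinates of \<open>z = (x, s)\<close>: \<open>x\<^sub>i\<close> for \<open>i \<le> m\<close> and \<open>s\<^sub>i\<^sub>-\<^sub>m\<close> for \<open>m < i \<le> m + p\<close>. They are embedded
  into the whole space, so that all of them have the same type.
\<close>

definition zcoord ::
  "nat \<Rightarrow> (nat \<Rightarrow> 'h::euclidean_space set) \<Rightarrow> nat \<Rightarrow> (nat \<Rightarrow> 'g::euclidean_space set) \<Rightarrow>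
   nat \<Rightarrow> 'h \<times> 'g \<Rightarrow> 'h \<times> 'g" where
  "zcoord m H p G i z =
     (if i \<le> m then (coord m H i (fst z), 0) else (0, coord p G (i - m) (snd z)))"


section \<open>Convex analysis\<close>

definition closed_proper_convex :: "('a::euclidean_space \<Rightarrow> ereal) \<Rightarrow> bool" where
  "closed_proper_convex \<phi> \<longleftrightarrow>
     closed {(x, r::real). \<phi> x \<le> ereal r} \<and>
     (\<forall>x. \<phi> x \<noteq> -\<infinity>) \<and> (\<exists>x. \<phi> x \<noteq> \<infinity>) \<and>
     convex {(x, r::real). \<phi> x \<le> ereal r}"

definition conjugate_on :: "'a::euclidean_space set \<Rightarrow> ('a \<Rightarrow> ereal) \<Rightarrow> 'a \<Rightarrow> ereal" where
  "conjugate_on V \<phi> s = (SUP x\<in>V. ereal (s \<bullet> x) - \<phi> x)"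

abbreviation conjugate :: "('a::euclidean_space \<Rightarrow> ereal) \<Rightarrow> 'a \<Rightarrow> ereal" where
  "conjugate \<equiv> conjugate_on UNIV"

definition subdifferential :: "('a::euclidean_space \<Rightarrow> ereal) \<Rightarrow> 'a \<Rightarrow> 'a set" where
  "subdifferential \<phi> x = {u. \<forall>y. \<phi> x + ereal (u \<bullet> (y - x)) \<le> \<phi> y}"

definition prox :: "real \<Rightarrow> ('a::euclidean_space \<Rightarrow> ereal) \<Rightarrow> 'a \<Rightarrow> 'a" where
  "prox \<gamma> \<phi> y = arg_min (\<lambda>x. \<phi> x + ereal (1 / (2 * \<gamma>) * (norm (x - y))\<^sup>2)) (\<lambda>_. True)"


section \<open>The primal-dual operator, its metric and its fixed points\<close>

definition T_CV ::
  "('h::euclidean_space \<Rightarrow> 'h) \<Rightarrow> ('h \<Rightarrow> ereal) \<Rightarrow> ('g::euclidean_space \<Rightarrow> ereal) \<Rightarrow> ('h \<Rightarrow> 'g) \<Rightarrow>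
   real \<Rightarrow> real \<Rightarrow> 'h \<times> 'g \<Rightarrow> 'h \<times> 'g" where
  "T_CV gradf g h A \<eta> \<gamma> = (\<lambda>(x, s).
     let s' = prox \<gamma> (conjugate h) (s + \<gamma> *\<^sub>R A x);
         x' = prox \<eta> g (x - \<eta> *\<^sub>R (gradf x + adjoint A (2 *\<^sub>R s' - s)))
     in (x', s'))"

definition M_CV ::
  "('h::euclidean_space \<Rightarrow> 'g::euclidean_space) \<Rightarrow> real \<Rightarrow> real \<Rightarrow> 'h \<times> 'g \<Rightarrow> 'h \<times> 'g" where
  "M_CV A \<eta> \<gamma> = (\<lambda>(x, s). ((1 / \<eta>) *\<^sub>R x + adjoint A s, A x + (1 / \<gamma>) *\<^sub>R s))"

definition positive_definite :: "('a::euclidean_space \<Rightarrow> 'a) \<Rightarrow> bool" where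
  "positive_definite M \<longleftrightarrow> (\<forall>z. z \<noteq> 0 \<longrightarrow> z \<bullet> M z > 0)"

definition norm_wrt :: "('a::euclidean_space \<Rightarrow> 'a) \<Rightarrow> 'a \<Rightarrow> real" where
  "norm_wrt M z = sqrt (z \<bullet> M z)"

definition nonexpansive_wrt ::
  "('a::euclidean_space \<Rightarrow> 'a) \<Rightarrow> ('a \<Rightarrow> 'a) \<Rightarrow> bool" where
  "nonexpansive_wrt M T \<longleftrightarrow> (\<forall>z z'. norm_wrt M (T z - T z') \<le> norm_wrt M (z - z'))"

definition eigenvalues :: "('a::euclidean_space \<Rightarrow> 'a) \<Rightarrow> real set" where
  "eigenvalues M = {l. \<exists>v. v \<noteq> 0 \<and> M v = l *\<^sub>R v}"

definition condition_number :: "('a::euclidean_space \<Rightarrow> 'a) \<Rightarrow> real" where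
  "condition_number M = Max (eigenvalues M) / Min (eigenvalues M)"

text \<open>
  The solution set of \<open>min f(x) + g(x) + h(A x)\<close>, as the set of primal-dual pairs \<open>(x, s)\<close> with
  \<open>0 \<in> \<nabla>f(x) + \<partial>g(x) + A\<^sup>T s\<close> and \<open>A x \<in> \<partial>h\<^sup>*(s)\<close>. For closed proper convex \<open>g\<close> and \<open>h\<^sup>*\<close> these
  are the fixed points of \<open>T_CV\<close>, for all \<open>\<eta>, \<gamma> > 0\<close>.
\<close>

definition Zstar ::
  "('h::euclidean_space \<Rightarrow> 'h) \<Rightarrow> ('h \<Rightarrow> ereal) \<Rightarrow> ('g::euclidean_space \<Rightarrow> ereal) \<Rightarrow> ('h \<Rightarrow> 'g) \<Rightarrow>
   ('h \<times> 'g) set" where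
  "Zstar gradf g h A = {(x, s).
     0 \<in> {gradf x + u + adjoint A s | u. u \<in> subdifferential g x} \<and>
     A x \<in> subdifferential (conjugate h) s}"


section \<open>Asynchronous reads\<close>

text \<open>
  Here \<open>z\<close> and \<open>zhat\<close> are single trajectories. The expression \<open>z (nat d)\<close> for an integer \<open>d\<close>
  implements the convention \<open>z\<^sup>d = z\<^sup>0\<close> for \<open>d < 0\<close>.
\<close>

definition read_model :: "nat \<Rightarrow> (nat \<Rightarrow> 'a::euclidean_space) \<Rightarrow> (nat \<Rightarrow> 'a) \<Rightarrow> bool" where
  "read_model \<tau> zhat z \<longleftrightarrow>
     (\<forall>k. \<exists>J \<subseteq> {int k - int \<tau> .. int k - 1}.
        zhat k = z k + (\<Sum>d\<in>J. z (nat d) - z (nat (d + 1))))"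

definition bounded_delays ::
  "nat \<Rightarrow> (nat \<Rightarrow> 'h::euclidean_space set) \<Rightarrow> nat \<Rightarrow> (nat \<Rightarrow> 'g::euclidean_space set) \<Rightarrow>
   nat \<Rightarrow> (nat \<Rightarrow> 'h \<times> 'g) \<Rightarrow> (nat \<Rightarrow> 'h \<times> 'g) \<Rightarrow> bool" where
  "bounded_delays m H p G \<tau> zhat z \<longleftrightarrow>
     (\<forall>k. \<forall>i\<in>{1..m + p}. \<exists>d\<le>\<tau>.
        zcoord m H p G i (zhat k) = zcoord m H p G i (z (nat (int k - int d))))"


section \<open>The two algorithms\<close>

text \<open>
  The argument \<open>idx k\<close> is the block index \<open>i\<^sub>k\<close>, and \<open>step k\<close> the step size \<open>\<eta>\<^sub>k\<close>.
\<close>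

definition algorithm1 ::
  "nat \<Rightarrow> (nat \<Rightarrow> 'h::euclidean_space set) \<Rightarrow> nat \<Rightarrow> (nat \<Rightarrow> 'g::euclidean_space set) \<Rightarrow>
   ('h \<times> 'g \<Rightarrow> 'h \<times> 'g) \<Rightarrow> (nat \<Rightarrow> real) \<Rightarrow> (nat \<Rightarrow> real) \<Rightarrow>
   (nat \<Rightarrow> nat) \<Rightarrow> (nat \<Rightarrow> 'h \<times> 'g) \<Rightarrow> (nat \<Rightarrow> 'h \<times> 'g) \<Rightarrow> bool" where
  "algorithm1 m H p G T q step idx zhat z \<longleftrightarrow>
     (\<forall>k.
        zcoord m H p G (idx k) (z (Suc k)) =
          zcoord m H p G (idx k) (z k)
          - (step k / (real (m + p) * q (idx k))) *\<^sub>R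
              (zcoord m H p G (idx k) (zhat k) - zcoord m H p G (idx k) (T (zhat k))) \<and>
        (\<forall>i\<in>{1..m + p}. i \<noteq> idx k \<longrightarrow>
          zcoord m H p G i (z (Suc k)) = zcoord m H p G i (z k)))"

text \<open>\<open>nonzero_block m H p G A j i\<close> says that the block \<open>A\<^sub>j\<^sub>,\<^sub>i : H i \<rightarrow> G j\<close> of \<open>A\<close> is not \<open>0\<close>.\<close>

definition nonzero_block ::
  "(nat \<Rightarrow> 'h::euclidean_space set) \<Rightarrow> nat \<Rightarrow> (nat \<Rightarrow> 'g::euclidean_space set) \<Rightarrow>
   ('h \<Rightarrow> 'g) \<Rightarrow> nat \<Rightarrow> nat \<Rightarrow> bool" where
  "nonzero_block H p G A j i \<longleftrightarrow> (\<exists>x\<in>H i. coord p G j (A x) \<noteq> 0)"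

definition dual_neighbours ::
  "(nat \<Rightarrow> 'h::euclidean_space set) \<Rightarrow> nat \<Rightarrow> (nat \<Rightarrow> 'g::euclidean_space set) \<Rightarrow>
   ('h \<Rightarrow> 'g) \<Rightarrow> nat \<Rightarrow> nat set" where
  "dual_neighbours H p G A i = {j\<in>{1..p}. nonzero_block H p G A j i}"

definition primal_neighbours ::
  "nat \<Rightarrow> (nat \<Rightarrow> 'h::euclidean_space set) \<Rightarrow> nat \<Rightarrow> (nat \<Rightarrow> 'g::euclidean_space set) \<Rightarrow>
   ('h \<Rightarrow> 'g) \<Rightarrow> nat \<Rightarrow> nat set" where
  "primal_neighbours m H p G A j = {i\<in>{1..m}. nonzero_block H p G A j i}"

definition overlapping_setting ::
  "nat \<Rightarrow> (nat \<Rightarrow> 'h::euclidean_space set) \<Rightarrow> nat \<Rightarrow> (nat \<Rightarrow> 'g::euclidean_space set) \<Rightarrow>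
   ('h \<Rightarrow> ereal) \<Rightarrow> ('g \<Rightarrow> ereal) \<Rightarrow> ('h \<Rightarrow> 'g) \<Rightarrow> (nat \<Rightarrow> nat \<Rightarrow> real) \<Rightarrow> bool" where
  "overlapping_setting m H p G g h A \<rho> \<longleftrightarrow>
     (\<exists>gs. \<forall>x. g x = (\<Sum>i=1..m. gs i (coord m H i x))) \<and>
     (\<exists>hs. \<forall>s. conjugate h s = (\<Sum>j=1..p. conjugate_on (G j) (hs j) (coord p G j s))) \<and>
     (\<forall>j\<in>{1..p}. primal_neighbours m H p G A j \<noteq> {}) \<and>
     (\<forall>i\<in>{1..m}. \<forall>j\<in>{1..p}. \<rho> i j \<ge> 0) \<and>
     (\<forall>j\<in>{1..p}. (\<Sum>i\<in>primal_neighbours m H p G A j. \<rho> i j) = 1)"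

definition algorithm2 ::
  "nat \<Rightarrow> (nat \<Rightarrow> 'h::euclidean_space set) \<Rightarrow> nat \<Rightarrow> (nat \<Rightarrow> 'g::euclidean_space set) \<Rightarrow>
   ('h \<Rightarrow> 'g) \<Rightarrow> (nat \<Rightarrow> nat \<Rightarrow> real) \<Rightarrow>
   ('h \<times> 'g \<Rightarrow> 'h \<times> 'g) \<Rightarrow> (nat \<Rightarrow> real) \<Rightarrow> (nat \<Rightarrow> real) \<Rightarrow>
   (nat \<Rightarrow> nat) \<Rightarrow> (nat \<Rightarrow> 'h \<times> 'g) \<Rightarrow> (nat \<Rightarrow> 'h \<times> 'g) \<Rightarrow> bool" where
  "algorithm2 m H p G A \<rho> T q step idx zhat z \<longleftrightarrow>
     (\<forall>k.
        coord m H (idx k) (fst (z (Suc k))) =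
          coord m H (idx k) (fst (z k))
          - (step k / (real m * q (idx k))) *\<^sub>R
              coord m H (idx k) (fst (zhat k - T (zhat k))) \<and>
        (\<forall>i\<in>{1..m}. i \<noteq> idx k \<longrightarrow>
          coord m H i (fst (z (Suc k))) = coord m H i (fst (z k))) \<and>
        (\<forall>j\<in>dual_neighbours H p G A (idx k).
          coord p G j (snd (z (Suc k))) =
            coord p G j (snd (z k))
            - (\<rho> (idx k) j * step k / (real m * q (idx k))) *\<^sub>R
                coord p G j (snd (zhat k - T (zhat k)))) \<and>
        (\<forall>j\<in>{1..p} - dual_neighbours H p G A (idx k).
          coord p G j (snd (z (Suc k))) = coord p G j (snd (z k))))"


section \<open>Random indices\<close>

text \<open>
  The events determined by the indices drawn before step \<open>k\<close> and by the reads up to and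
  including the one used in step \<open>k\<close>.
\<close>

definition history ::
  "'w measure \<Rightarrow> (nat \<Rightarrow> 'w \<Rightarrow> nat) \<Rightarrow> (nat \<Rightarrow> 'w \<Rightarrow> 'a::euclidean_space) \<Rightarrow> nat \<Rightarrow> 'w set set"
where
  "history P idx zhat k = sigma_sets (space P)
     ({idx l -` B \<inter> space P | l B. l < k} \<union>
      {zhat l -` B \<inter> space P | l B. l \<le> k \<and> B \<in> sets borel})"

text \<open>
  The delays, hence the reads, may be random, but an index must not influence the read it is
  combined with: \<open>idx k\<close> is independent of \<open>history P idx zhat k\<close>. This entails that the \<open>idx k\<close>
  are mutually independent; conversely, when the delays are deterministic, mutual independence
  entails it, since then each read is a function of the earlier indices.
\<close>

definition random_indices ::
  "'w measure \<Rightarrow> nat \<Rightarrow> (nat \<Rightarrow> real) \<Rightarrow> (nat \<Rightarrow> 'w \<Rightarrow> nat) \<Rightarrow>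
   (nat \<Rightarrow> 'w \<Rightarrow> 'a::euclidean_space) \<Rightarrow> bool" where
  "random_indices P n q idx zhat \<longleftrightarrow>
     (\<forall>k. idx k \<in> measurable P (count_space UNIV)) \<and>
     (\<forall>k. zhat k \<in> borel_measurable P) \<and>
     (\<forall>k. \<forall>\<omega>\<in>space P. idx k \<omega> \<in> {1..n}) \<and>
     (\<forall>k. \<forall>i\<in>{1..n}. measure P {\<omega>\<in>space P. idx k \<omega> = i} = q i) \<and>
     (\<forall>k. prob_space.indep_set P (history P idx zhat k) {idx k -` B \<inter> space P | B. True})"

end

(*
  Write S = I - T. Nonexpansiveness of T in the M-norm makes S (1/2)-cocoercive, and the block
  operators U_i of either algorithm sum to the identity and satisfy sum_i |U_i v|^2 <= |v|^2. Hence
  an index that is independent of the past makes, for every fixed point w, the Lyapunov function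

    |z^k - w|_M^2 + c * sum_{d<k} max(d + tau + 1 - k, 0) * |z^{d+1} - z^d|_M^2

  a nonnegative supermartingale that decreases on average by a multiple of |S zhat^k|_M^2: the
  delayed part of the inner product <S zhat^k, z^k - w>_M is absorbed by the weighted sum of recent
  displacements, and the step size bound is exactly what leaves a positive multiple. So, almost
  surely, S zhat^k -> 0, all displacements vanish, and |z^k - w|_M converges for all w in a countable
  dense set of fixed points, whence z^k converges to a fixed point by Opial's argument. Fixed points
  of T are the primal-dual solutions by the optimality condition characterising prox.
*)
theory Submission
  imports Defs
begin

section \<open>Proximal points and subgradients\<close>

text \<open>Two metrics compete. The blocks obey a Pythagorean bound in the Euclidean norm, whereas
  \<open>T\<close> is nonexpansive only in the norm of \<open>M\<close>; passing from one to the
  other costs the ratio of the extreme eigenvalues, and this is how \<kappa> enters the step size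
  bound. The weights 1 / (n q_i) cancel the sampling probabilities in the linear term of the
  expansion, so that on average the step goes along S zhat^k / n, but in the quadratic term one
  factor 1 / q_i survives, whence qmin.

  Reads may be random, so zhat^k need not be a function of the earlier indices. It is therefore made
  part of the history, and the index is averaged out while zhat^k is frozen. Integrals over events
  of the past stand in for conditional expectations. Integrability comes from boundedness: at each
  time only finitely many indices and read patterns are possible, and the initial point is
  deterministic.

  Finally, \<open>prox\<close> is a chosen minimiser, so its optimality condition presupposes that a
  minimiser exists. The solution assumed to exist supplies the subgradients that guarantee
  this.\<close>

lemma nonneg_if_quadratic_nonneg_near_zero:
  fixes a b :: real
  assumes "\<And>t. 0 < t \<Longrightarrow> t < 1 \<Longrightarrow> 0 \<le> t * a + t\<^sup>2 * b"
  shows "0 \<le> a"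
proof (rule tendsto_lowerbound)
  show "((\<lambda>t. a + t * b) \<longlongrightarrow> a) (at_right 0)"
    by (auto intro!: tendsto_eq_intros)
  have "\<forall>\<^sub>F t in at_right (0::real). t \<in> {0<..<1}"
    using eventually_at_right_real[of 0 1] by simp
  then show "\<forall>\<^sub>F t in at_right 0. 0 \<le> a + t * b"
  proof (rule eventually_mono)
    fix t :: real assume t: "t \<in> {0<..<1}"
    then have "0 \<le> t * (a + t * b)"
      using assms[of t] by (simp add: power2_eq_square algebra_simps)
    then show "0 \<le> a + t * b" using t by (simp add: zero_le_mult_iff)
  qed
qed simp

lemma closed_proper_convex_subgradient_finite:
  assumes "closed_proper_convex \<phi>" "u \<in> subdifferential \<phi> x"
  obtains c where "\<phi> x = ereal c" "\<And>y. ereal (c + u \<bullet> (y - x)) \<le> \<phi> y"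
proof -
  obtain w where "\<phi> w \<noteq> \<infinity>" using assms(1) by (auto simp: closed_proper_convex_def)
  moreover have "\<phi> x + ereal (u \<bullet> (w - x)) \<le> \<phi> w"
    using assms(2) by (auto simp: subdifferential_def)
  ultimately have "\<phi> x \<noteq> \<infinity>" by auto
  moreover have "\<phi> x \<noteq> -\<infinity>" using assms(1) by (auto simp: closed_proper_convex_def)
  ultimately obtain c where c: "\<phi> x = ereal c" by (cases "\<phi> x") auto
  show thesis
    by (rule that[OF c]) (use assms(2) c in \<open>auto simp: subdifferential_def\<close>)
qed

text \<open>The centre \<open>p\<close> is free. If \<open>p\<close> is the minimiser, the linear
  term is the candidate subgradient; if \<open>p = y - \<gamma> *\<^sub>R u\<close>, it is the given
  \<open>u\<close>, which completes the square.\<close>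

lemma quadratic_expansion:
  fixes x y p :: "'a::real_inner"
  assumes "\<gamma> \<noteq> 0"
  shows "1 / (2 * \<gamma>) * (norm (x - y))\<^sup>2 =
    1 / (2 * \<gamma>) * (norm (p - y))\<^sup>2 + 1 / (2 * \<gamma>) * (norm (x - p))\<^sup>2
    - ((1 / \<gamma>) *\<^sub>R (y - p)) \<bullet> (x - p)"
  using assms
  by (simp add: power2_norm_eq_inner inner_diff_left inner_diff_right inner_commute field_simps)

text \<open>The subgradient inequality and the expansion around \<open>p\<close> together leave the
  surplus \<open>1 / (2 * \<gamma>) * (norm (x - p))\<^sup>2\<close> over the value at
  \<open>p\<close>. The minimum is thus strict, which pins down the choice hidden in
  \<open>arg_min\<close>.\<close>

lemma prox_eqI:
  assumes cpc: "closed_proper_convex \<phi>" and "\<gamma> > 0"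
    and sub: "(1 / \<gamma>) *\<^sub>R (y - p) \<in> subdifferential \<phi> p"
  shows "prox \<gamma> \<phi> y = p"
proof -
  let ?q = "\<lambda>x. 1 / (2 * \<gamma>) * (norm (x - y))\<^sup>2"
  obtain c where c: "\<phi> p = ereal c"
    and le: "\<And>x. ereal (c + ((1 / \<gamma>) *\<^sub>R (y - p)) \<bullet> (x - p)) \<le> \<phi> x"
    using closed_proper_convex_subgradient_finite[OF cpc sub] by blast
  have key: "\<phi> p + ereal (?q p) + ereal (1 / (2 * \<gamma>) * (norm (x - p))\<^sup>2) \<le> \<phi> x + ereal (?q x)" for x
  proof -
    have "\<phi> p + ereal (?q p) + ereal (1 / (2 * \<gamma>) * (norm (x - p))\<^sup>2)
        = ereal (c + ((1 / \<gamma>) *\<^sub>R (y - p)) \<bullet> (x - p)) + ereal (?q x)"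
      using quadratic_expansion[of \<gamma> x y p] \<open>\<gamma> > 0\<close> c by simp
    also have "\<dots> \<le> \<phi> x + ereal (?q x)" by (intro add_right_mono le)
    finally show ?thesis .
  qed
  have strict: "\<phi> p + ereal (?q p) < \<phi> x + ereal (?q x)" if "x \<noteq> p" for x
  proof -
    have "0 < 1 / (2 * \<gamma>) * (norm (x - p))\<^sup>2" using that \<open>\<gamma> > 0\<close> by simp
    then have "\<phi> p + ereal (?q p) < \<phi> p + ereal (?q p) + ereal (1 / (2 * \<gamma>) * (norm (x - p))\<^sup>2)"
      using c by simp
    then show ?thesis using key[of x] by (rule less_le_trans)
  qed
  show ?thesis
    unfolding prox_def arg_min_def is_arg_min_def
    by (rule some_equality) (use strict in \<open>force dest: less_asym\<close>)+
qed

text \<open>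
  A subgradient at any one point supplies the affine minorant that makes the objective coercive.
\<close>

lemma prox_minimizer_exists:
  fixes \<phi> :: "'a::euclidean_space \<Rightarrow> ereal"
  assumes cpc: "closed_proper_convex \<phi>" and "\<gamma> > 0" and sub: "u \<in> subdifferential \<phi> x0"
  obtains p where "\<And>x. \<phi> p + ereal (1 / (2 * \<gamma>) * (norm (p - y))\<^sup>2)
    \<le> \<phi> x + ereal (1 / (2 * \<gamma>) * (norm (x - y))\<^sup>2)"
proof -
  let ?q = "\<lambda>x. 1 / (2 * \<gamma>) * (norm (x - y))\<^sup>2"
  obtain c where c: "\<phi> x0 = ereal c" and le: "\<And>x. ereal (c + u \<bullet> (x - x0)) \<le> \<phi> x"
    using closed_proper_convex_subgradient_finite[OF cpc sub] by blast
  define C where "C = c + ?q x0"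
  \<comment> \<open>The objective is extended-valued and merely lower semicontinuous. Over the
    epigraph it becomes the continuous function \<open>r + ?q x\<close> on a closed set, cut off at
    the value \<open>C\<close> attained at \<open>x0\<close>.\<close>
  define K where "K = {(x, r). \<phi> x \<le> ereal r} \<inter> {(x, r). r + ?q x \<le> C}"
  \<comment> \<open>Affine minorant plus \<open>?q\<close> is again a quadratic: \<open>w\<close> is
    its minimiser and \<open>R\<close> the radius of its sublevel set at height
    \<open>C\<close>.\<close>
  define w where "w = y - \<gamma> *\<^sub>R u"
  define R where "R = sqrt (2 * \<gamma> * (C - c - u \<bullet> (w - x0)) - (norm (w - y))\<^sup>2)"
  have "closed K"
    unfolding K_def
  proof (rule closed_Int)
    show "closed {(x, r::real). \<phi> x \<le> ereal r}" using cpc by (simp add: closed_proper_convex_def)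
    show "closed {(x, r). r + ?q x \<le> C}"
      unfolding case_prod_beta by (intro closed_Collect_le continuous_intros)
  qed
  moreover have "K \<subseteq> cball w R \<times> {c - norm u * (R + norm (w - x0)) .. C}"
  proof clarify
    fix x r assume "(x, r) \<in> K"
    then have 1: "\<phi> x \<le> ereal r" and 2: "r + ?q x \<le> C" by (auto simp: K_def)
    have r: "c + u \<bullet> (x - x0) \<le> r" using order_trans[OF le[of x] 1] by simp
    then have "c + u \<bullet> (x - x0) + ?q x \<le> C" using 2 by linarith
    moreover have "(1 / \<gamma>) *\<^sub>R (y - w) = u" using \<open>\<gamma> > 0\<close> by (simp add: w_def)
    then have "?q x = ?q w + 1 / (2 * \<gamma>) * (norm (x - w))\<^sup>2 - u \<bullet> (x - w)"
      using quadratic_expansion[of \<gamma> x y w] \<open>\<gamma> > 0\<close> by simp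
    moreover have "u \<bullet> (x - x0) - u \<bullet> (x - w) = u \<bullet> (w - x0)"
      by (simp add: inner_diff_right)
    ultimately have "1 / (2 * \<gamma>) * (norm (x - w))\<^sup>2 \<le> C - c - u \<bullet> (w - x0) - ?q w"
      by linarith
    then have "(norm (x - w))\<^sup>2 \<le> 2 * \<gamma> * (C - c - u \<bullet> (w - x0)) - (norm (w - y))\<^sup>2"
      using \<open>\<gamma> > 0\<close> by (simp add: field_simps)
    then have xw: "norm (x - w) \<le> R" unfolding R_def by (rule real_le_rsqrt)
    have "- (u \<bullet> (x - x0)) \<le> norm u * norm (x - x0)"
      using Cauchy_Schwarz_ineq2[of u "x - x0"] by linarith
    also have "\<dots> \<le> norm u * (R + norm (w - x0))"
      by (intro mult_left_mono) (use norm_triangle_ineq[of "x - w" "w - x0"] xw in auto)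
    finally have "c - norm u * (R + norm (w - x0)) \<le> r" using r by linarith
    moreover have "0 \<le> ?q x" using \<open>\<gamma> > 0\<close> by simp
    then have "r \<le> C" using 2 by linarith
    ultimately show "x \<in> cball w R \<and> r \<in> {c - norm u * (R + norm (w - x0)) .. C}"
      using xw by (simp add: dist_norm norm_minus_commute)
  qed
  then have "bounded K"
    by (rule bounded_subset[rotated]) (intro bounded_Times bounded_cball bounded_closed_interval)
  ultimately have "compact K" by (simp add: compact_eq_bounded_closed)
  moreover have x0: "(x0, c) \<in> K" by (simp add: K_def C_def c)
  moreover have "continuous_on K (\<lambda>(x, r). r + ?q x)"
    unfolding case_prod_beta by (intro continuous_intros)
  ultimately obtain k where "k \<in> K" "\<forall>l\<in>K. (\<lambda>(x, r). r + ?q x) k \<le> (\<lambda>(x, r). r + ?q x) l"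
    using continuous_attains_inf[of K "\<lambda>(x, r). r + ?q x"] by blast
  then obtain p r where K: "(p, r) \<in> K" and min: "\<And>x s. (x, s) \<in> K \<Longrightarrow> r + ?q p \<le> s + ?q x"
    by (cases k) fastforce
  show thesis
  proof
    fix x
    have p: "\<phi> p + ereal (?q p) \<le> ereal (r + ?q p)"
      using K by (auto simp: K_def intro: add_right_mono simp flip: plus_ereal.simps)
    show "\<phi> p + ereal (?q p) \<le> \<phi> x + ereal (?q x)"
    proof (cases "\<phi> x")
      case (real s)
      show ?thesis
      proof (cases "s + ?q x \<le> C")
        case True
        then have "(x, s) \<in> K" using real by (simp add: K_def)
        then show ?thesis using order_trans[OF p] min real by simp
      next
        case False
        have "r + ?q p \<le> C" using K by (auto simp: K_def)
        then show ?thesis using order_trans[OF p] False real by simp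
      qed
    next
      case PInf
      then show ?thesis by simp
    next
      case MInf
      then show ?thesis using cpc by (auto simp: closed_proper_convex_def)
    qed
  qed
qed

text \<open>Comparing \<open>p\<close> with \<open>p + t *\<^sub>R (x - p)\<close> and using
  convexity of the epigraph, the curvature of the quadratic contributes only to order t^2 and drops
  out as t tends to 0.\<close>

lemma prox_minimizer_subgradient:
  fixes \<phi> :: "'a::euclidean_space \<Rightarrow> ereal"
  assumes cpc: "closed_proper_convex \<phi>" and "\<gamma> > 0"
    and min: "\<And>x. \<phi> p + ereal (1 / (2 * \<gamma>) * (norm (p - y))\<^sup>2)
      \<le> \<phi> x + ereal (1 / (2 * \<gamma>) * (norm (x - y))\<^sup>2)"
  shows "(1 / \<gamma>) *\<^sub>R (y - p) \<in> subdifferential \<phi> p"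
proof -
  let ?q = "\<lambda>x. 1 / (2 * \<gamma>) * (norm (x - y))\<^sup>2"
  let ?v = "(1 / \<gamma>) *\<^sub>R (y - p)"
  have proper: "\<phi> x \<noteq> -\<infinity>" for x using cpc by (auto simp: closed_proper_convex_def)
  obtain w where "\<phi> w \<noteq> \<infinity>" using cpc by (auto simp: closed_proper_convex_def)
  then have "\<phi> p \<noteq> \<infinity>" using min[of w] by auto
  then obtain c where c: "\<phi> p = ereal c" using proper[of p] by (cases "\<phi> p") auto
  have "\<phi> p + ereal (?v \<bullet> (x - p)) \<le> \<phi> x" for x
  proof (cases "\<phi> x")
    case (real d)
    have "0 \<le> d - c - ?v \<bullet> (x - p)"
    proof (rule nonneg_if_quadratic_nonneg_near_zero)
      fix t :: real assume t: "0 < t" "t < 1"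
      let ?x = "p + t *\<^sub>R (x - p)"
      have "(1 - t) *\<^sub>R (p, c) + t *\<^sub>R (x, d) \<in> {(x, r). \<phi> x \<le> ereal r}"
        using cpc c real t unfolding closed_proper_convex_def
        by (intro convexD_alt) auto
      then have "\<phi> ?x \<le> ereal ((1 - t) * c + t * d)"
        by (simp add: algebra_simps)
      then have "\<phi> ?x + ereal (?q ?x) \<le> ereal ((1 - t) * c + t * d) + ereal (?q ?x)"
        by (rule add_right_mono)
      with min[of ?x] have "c + ?q p \<le> (1 - t) * c + t * d + ?q ?x"
        using c by (auto dest: order_trans)
      moreover have "?q ?x = ?q p + t\<^sup>2 * (1 / (2 * \<gamma>) * (norm (x - p))\<^sup>2) - t * (?v \<bullet> (x - p))"
      proof -
        have "?x - p = t *\<^sub>R (x - p)" by simp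
        then show ?thesis
          using quadratic_expansion[of \<gamma> ?x y p] \<open>\<gamma> > 0\<close>
          by (simp only: inner_scaleR_right norm_scaleR power_mult_distrib power2_abs) simp
      qed
      ultimately show "0 \<le> t * (d - c - ?v \<bullet> (x - p)) + t\<^sup>2 * (1 / (2 * \<gamma>) * (norm (x - p))\<^sup>2)"
        by (simp add: algebra_simps)
    qed
    then show ?thesis using c real by simp
  qed (use proper in auto)
  then show ?thesis by (simp add: subdifferential_def)
qed

text \<open>\<open>prox\<close> is a choice operator, so its value can be trusted to satisfy the
  optimality condition only once some minimiser exists; a subgradient at an arbitrary point
  \<open>x0\<close> ensures that.\<close>

lemma prox_eq_iff:
  fixes \<phi> :: "'a::euclidean_space \<Rightarrow> ereal"
  assumes "closed_proper_convex \<phi>" "\<gamma> > 0" "u \<in> subdifferential \<phi> x0"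
  shows "prox \<gamma> \<phi> y = p \<longleftrightarrow> (1 / \<gamma>) *\<^sub>R (y - p) \<in> subdifferential \<phi> p"
proof
  obtain p' where "\<And>x. \<phi> p' + ereal (1 / (2 * \<gamma>) * (norm (p' - y))\<^sup>2)
      \<le> \<phi> x + ereal (1 / (2 * \<gamma>) * (norm (x - y))\<^sup>2)"
    using prox_minimizer_exists[OF assms] by blast
  then have sub: "(1 / \<gamma>) *\<^sub>R (y - p') \<in> subdifferential \<phi> p'"
    by (rule prox_minimizer_subgradient[OF assms(1,2)])
  assume "prox \<gamma> \<phi> y = p"
  then have "p' = p" using prox_eqI[OF assms(1,2) sub] by simp
  then show "(1 / \<gamma>) *\<^sub>R (y - p) \<in> subdifferential \<phi> p" using sub by simp
qed (rule prox_eqI[OF assms(1,2)])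

text \<open>A known solution provides the subgradients from which both proximal maps get their
  minimisers. The dual equation comes first: once \<open>s' = s\<close>, the extrapolation
  \<open>2 *\<^sub>R s' - s\<close> collapses to \<open>s\<close>.\<close>

lemma Zstar_eq_fixed_points:
  assumes g: "closed_proper_convex g" and h: "closed_proper_convex (conjugate h)"
    and "\<eta> > 0" "\<gamma> > 0" and ne: "Zstar gradf g h A \<noteq> {}"
  shows "Zstar gradf g h A = {z. T_CV gradf g h A \<eta> \<gamma> z = z}"
proof -
  obtain x0 s0 u where "u \<in> subdifferential g x0" "A x0 \<in> subdifferential (conjugate h) s0"
    using ne by (auto simp: Zstar_def)
  note prox_g = prox_eq_iff[OF g \<open>\<eta> > 0\<close> this(1)] and prox_h = prox_eq_iff[OF h \<open>\<gamma> > 0\<close> this(2)]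
  have "T_CV gradf g h A \<eta> \<gamma> (x, s) = (x, s) \<longleftrightarrow> (x, s) \<in> Zstar gradf g h A" for x s
  proof -
    have *: "prox \<gamma> (conjugate h) (s + \<gamma> *\<^sub>R A x) = s \<longleftrightarrow> A x \<in> subdifferential (conjugate h) s"
      unfolding prox_h using \<open>\<gamma> > 0\<close> by simp
    have "prox \<eta> g (x - \<eta> *\<^sub>R (gradf x + adjoint A s)) = x \<longleftrightarrow>
        - (gradf x + adjoint A s) \<in> subdifferential g x"
      unfolding prox_g using \<open>\<eta> > 0\<close> by (simp add: algebra_simps)
    also have "\<dots> \<longleftrightarrow> (\<exists>u\<in>subdifferential g x. gradf x + u + adjoint A s = 0)"
      by (metis (no_types, lifting) add.commute add.left_commute eq_neg_iff_add_eq_0)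
    finally have **: "prox \<eta> g (x - \<eta> *\<^sub>R (gradf x + adjoint A s)) = x \<longleftrightarrow>
        (\<exists>u\<in>subdifferential g x. gradf x + u + adjoint A s = 0)" .
    have "2 *\<^sub>R s - s = s" by (simp add: scaleR_2)
    then have "T_CV gradf g h A \<eta> \<gamma> (x, s) = (x, s) \<longleftrightarrow>
        prox \<gamma> (conjugate h) (s + \<gamma> *\<^sub>R A x) = s \<and>
        prox \<eta> g (x - \<eta> *\<^sub>R (gradf x + adjoint A s)) = x"
      by (auto simp: T_CV_def Let_def)
    then show ?thesis unfolding * ** by (auto simp: Zstar_def)
  qed
  then show ?thesis by (auto simp: set_eq_iff)
qed

section \<open>Extreme eigenvalues of symmetric operators\<close>

locale symmetric_operator =
  fixes M :: "'a::euclidean_space \<Rightarrow> 'a"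
  assumes linear_M: "linear M" and symmetric: "x \<bullet> M y = y \<bullet> M x"

text \<open>Moving \<open>v\<close> by \<open>- t *\<^sub>R N v\<close> changes the quadratic form
  to first order by -2 t |N v|^2, which would make it negative unless \<open>N v = 0\<close>. For
  \<open>l *\<^sub>R x - M x\<close> this turns a maximiser of the Rayleigh quotient into an
  eigenvector without calculus.\<close>

lemma psd_zero_imp_kernel:
  fixes N :: "'a::euclidean_space \<Rightarrow> 'a"
  assumes "symmetric_operator N" and psd: "\<And>x. 0 \<le> x \<bullet> N x" and v: "v \<bullet> N v = 0"
  shows "N v = 0"
proof -
  interpret symmetric_operator N by fact
  let ?w = "N v"
  have "0 \<le> t * (- 2 * (?w \<bullet> ?w)) + t\<^sup>2 * (?w \<bullet> N ?w)" for t
  proof -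
    have "0 \<le> (v - t *\<^sub>R ?w) \<bullet> N (v - t *\<^sub>R ?w)" by (rule psd)
    also have "\<dots> = t * (- 2 * (?w \<bullet> ?w)) + t\<^sup>2 * (?w \<bullet> N ?w)"
    proof -
      have "v \<bullet> N ?w = ?w \<bullet> ?w" by (rule symmetric)
      then show ?thesis
        using v by (simp add: linear_diff[OF linear_M] linear_scale[OF linear_M] inner_diff_left
            inner_diff_right power2_eq_square right_diff_distrib)
    qed
    finally show ?thesis .
  qed
  then have "0 \<le> - 2 * (?w \<bullet> ?w)" by (rule nonneg_if_quadratic_nonneg_near_zero)
  then have "?w \<bullet> ?w = 0" using inner_ge_zero[of ?w] by linarith
  then show ?thesis by simp
qed

context symmetric_operator
begin

lemma continuous_on_M: "continuous_on X M"
  using linear_M by (rule linear_continuous_on[OF linear_conv_bounded_linear[THEN iffD1]])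

lemma Rayleigh_scaled:
  assumes "\<And>u. norm u = 1 \<Longrightarrow> u \<bullet> M u \<le> l"
  shows "x \<bullet> M x \<le> l * (norm x)\<^sup>2"
proof (cases "x = 0")
  case False
  define u where "u = (1 / norm x) *\<^sub>R x"
  have "norm u = 1" and x: "x = norm x *\<^sub>R u" using False by (simp_all add: u_def)
  have "x \<bullet> M x = (norm x)\<^sup>2 * (u \<bullet> M u)"
    by (subst (1 2) x)
      (simp only: inner_scaleR_left inner_scaleR_right linear_scale[OF linear_M] mult.assoc power2_eq_square)
  also have "\<dots> \<le> (norm x)\<^sup>2 * l" using assms[OF \<open>norm u = 1\<close>] by (intro mult_left_mono) auto
  finally show ?thesis by (simp add: mult.commute)
qed (simp add: linear_0[OF linear_M])

lemma max_eigenvalue: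
  obtains l where "l \<in> eigenvalues M" "\<And>x. x \<bullet> M x \<le> l * (norm x)\<^sup>2"
proof -
  have "sphere (0::'a) 1 \<noteq> {}"
    using vector_choose_size[of 1, where 'a = 'a] by auto
  moreover have "continuous_on (sphere 0 1) (\<lambda>x. x \<bullet> M x)"
    by (intro continuous_intros continuous_on_M)
  ultimately obtain v where v: "norm v = 1" and max: "\<And>u. norm u = 1 \<Longrightarrow> u \<bullet> M u \<le> v \<bullet> M v"
    using continuous_attains_sup[OF compact_sphere, of "0::'a" 1 "\<lambda>x. x \<bullet> M x"] by auto
  define l where "l = v \<bullet> M v"
  have le: "x \<bullet> M x \<le> l * (norm x)\<^sup>2" for x
    by (rule Rayleigh_scaled) (simp add: l_def max)
  have "symmetric_operator (\<lambda>x. l *\<^sub>R x - M x)"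
  proof (rule symmetric_operator.intro)
    show "linear (\<lambda>x. l *\<^sub>R x - M x)"
      by (intro linear_compose_sub linear_M linear_scaleR)
    show "x \<bullet> (l *\<^sub>R y - M y) = y \<bullet> (l *\<^sub>R x - M x)" for x y
      using symmetric[of x y] inner_commute[of x y] by (metis inner_diff_right inner_scaleR_right)
  qed
  moreover have "0 \<le> x \<bullet> (l *\<^sub>R x - M x)" for x
    using le[of x] by (simp add: inner_diff_right power2_norm_eq_inner)
  moreover have "v \<bullet> (l *\<^sub>R v - M v) = 0"
    using v by (simp add: inner_diff_right l_def flip: power2_norm_eq_inner)
  ultimately have "l *\<^sub>R v - M v = 0" by (rule psd_zero_imp_kernel)
  moreover have "v \<noteq> 0" using v by auto
  ultimately have "l \<in> eigenvalues M" by (auto simp: eigenvalues_def)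
  then show thesis using le that by blast
qed

lemma symmetric_operator_uminus: "symmetric_operator (\<lambda>x. - M x)"
proof (rule symmetric_operator.intro)
  show "linear (\<lambda>x. - M x)" by (intro linear_compose_neg linear_M)
  show "x \<bullet> - M y = y \<bullet> - M x" for x y using symmetric[of x y] by simp
qed

lemma min_eigenvalue:
  obtains l where "l \<in> eigenvalues M" "\<And>x. l * (norm x)\<^sup>2 \<le> x \<bullet> M x"
proof -
  obtain l where l: "l \<in> eigenvalues (\<lambda>x. - M x)" "\<And>x. x \<bullet> - M x \<le> l * (norm x)\<^sup>2"
    using symmetric_operator.max_eigenvalue[OF symmetric_operator_uminus] by blast
  show thesis
  proof
    show "- l \<in> eigenvalues M"
    proof -
      obtain v where "v \<noteq> 0" "- M v = l *\<^sub>R v" using l(1) by (auto simp: eigenvalues_def)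
      moreover from this(2) have "M v = (- l) *\<^sub>R v"
        by (metis minus_minus scaleR_minus_left)
      ultimately show ?thesis by (auto simp: eigenvalues_def)
    qed
    show "- l * (norm x)\<^sup>2 \<le> x \<bullet> M x" for x using l(2)[of x] by simp
  qed
qed

text \<open>Eigenvectors for distinct eigenvalues are orthogonal, so one of each forms an
  independent set in finite dimension. Finiteness gives \<open>Max\<close> and \<open>Min\<close> in
  \<open>condition_number\<close> their meaning.\<close>

lemma finite_eigenvalues: "finite (eigenvalues M)"
proof -
  have "\<forall>l. \<exists>v. l \<in> eigenvalues M \<longrightarrow> v \<noteq> 0 \<and> M v = l *\<^sub>R v"
    by (auto simp: eigenvalues_def)
  then obtain v where v: "\<And>l. l \<in> eigenvalues M \<Longrightarrow> v l \<noteq> 0 \<and> M (v l) = l *\<^sub>R v l"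
    by metis
  have orth: "orthogonal (v l) (v l')"
    if "l \<in> eigenvalues M" "l' \<in> eigenvalues M" "l \<noteq> l'" for l l'
  proof -
    have "l' * (v l \<bullet> v l') = l * (v l \<bullet> v l')"
    proof -
      have "v l \<bullet> M (v l') = v l' \<bullet> M (v l)" by (rule symmetric)
      then show ?thesis
        by (simp only: v[OF that(1)] v[OF that(2)] inner_scaleR_right inner_commute[of "v l'" "v l"])
    qed
    then show ?thesis using that(3) by (simp add: orthogonal_def)
  qed
  have inj: "inj_on v (eigenvalues M)"
  proof
    fix l l' assume "l \<in> eigenvalues M" "l' \<in> eigenvalues M" "v l = v l'"
    then show "l = l'" using orth[of l l'] v[of l] by (auto simp: orthogonal_self)
  qed
  have "independent (v ` eigenvalues M)"
  proof (rule pairwise_orthogonal_independent)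
    show "pairwise orthogonal (v ` eigenvalues M)"
    proof (rule pairwiseI, clarify)
      fix l l' assume "l \<in> eigenvalues M" "l' \<in> eigenvalues M" "v l \<noteq> v l'"
      then show "orthogonal (v l) (v l')" using orth[of l l'] by blast
    qed
    show "0 \<notin> v ` eigenvalues M" using v by force
  qed
  then have "finite (v ` eigenvalues M)" using independent_bound by blast
  then show ?thesis using inj by (rule finite_imageD)
qed

lemma le_Max_eigenvalue: "x \<bullet> M x \<le> Max (eigenvalues M) * (norm x)\<^sup>2"
proof -
  obtain l where l: "l \<in> eigenvalues M" "\<And>x. x \<bullet> M x \<le> l * (norm x)\<^sup>2" using max_eigenvalue by blast
  have "l * (norm x)\<^sup>2 \<le> Max (eigenvalues M) * (norm x)\<^sup>2"
    using l(1) finite_eigenvalues by (intro mult_right_mono Max_ge) auto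
  then show ?thesis using l(2)[of x] by linarith
qed

lemma Min_eigenvalue_le: "Min (eigenvalues M) * (norm x)\<^sup>2 \<le> x \<bullet> M x"
proof -
  obtain l where l: "l \<in> eigenvalues M" "\<And>x. l * (norm x)\<^sup>2 \<le> x \<bullet> M x" using min_eigenvalue by blast
  have "Min (eigenvalues M) * (norm x)\<^sup>2 \<le> l * (norm x)\<^sup>2"
    using l(1) finite_eigenvalues by (intro mult_right_mono Min_le) auto
  then show ?thesis using l(2)[of x] by linarith
qed

lemma Min_eigenvalue_pos:
  assumes "positive_definite M"
  shows "0 < Min (eigenvalues M)"
proof -
  have "eigenvalues M \<noteq> {}" using max_eigenvalue by blast
  then have "Min (eigenvalues M) \<in> eigenvalues M" using finite_eigenvalues by simp
  then obtain v where v: "v \<noteq> 0" "M v = Min (eigenvalues M) *\<^sub>R v" by (auto simp: eigenvalues_def)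
  have "0 < v \<bullet> M v" using assms v(1) by (simp add: positive_definite_def)
  then have "0 < Min (eigenvalues M) * (v \<bullet> v)" by (simp add: v(2))
  then show ?thesis using inner_ge_zero[of v] by (simp only: zero_less_mult_iff) linarith
qed

end

lemma symmetric_operator_M_CV:
  fixes A :: "'h::euclidean_space \<Rightarrow> 'g::euclidean_space"
  assumes "linear A"
  shows "symmetric_operator (M_CV A \<eta> \<gamma>)"
proof (rule symmetric_operator.intro)
  have "linear (adjoint A)" using assms by (rule adjoint_linear)
  note lin = linear_add[OF assms] linear_scale[OF assms] linear_add[OF this] linear_scale[OF this]
  show "linear (M_CV A \<eta> \<gamma>)"
    by (rule linearI) (auto simp: M_CV_def lin algebra_simps)
  have adj: "t \<bullet> A x = x \<bullet> adjoint A t" for x t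
    using adjoint_works[OF assms, of x t] by (simp add: inner_commute)
  show "z \<bullet> M_CV A \<eta> \<gamma> w = w \<bullet> M_CV A \<eta> \<gamma> z" for z w
    by (cases z; cases w) (simp add: M_CV_def inner_add_right adj inner_commute)
qed

section \<open>Coordinate blocks\<close>

context
  fixes n :: nat and V :: "nat \<Rightarrow> 'a::euclidean_space set"
  assumes hp: "hilbert_product n V"
begin

lemma subspace_factor: "i \<in> {1..n} \<Longrightarrow> subspace (V i)"
  using hp by (simp add: hilbert_product_def)

lemma orthogonal_factors:
  "\<lbrakk>i \<in> {1..n}; l \<in> {1..n}; i \<noteq> l; u \<in> V i; v \<in> V l\<rbrakk> \<Longrightarrow> u \<bullet> v = 0"
  using hp by (simp add: hilbert_product_def orthogonal_def)

lemma decomposition_exists: "\<exists>u. (\<forall>l\<in>{1..n}. u l \<in> V l) \<and> x = (\<Sum>l=1..n. u l)"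
proof -
  have "x \<in> span (\<Union>i\<in>{1..n}. V i)" using hp by (simp add: hilbert_product_def)
  then show ?thesis
  proof (induction x rule: span_induct_alt)
    case base
    show ?case by (rule exI[of _ "\<lambda>_. 0"]) (simp add: subspace_0 subspace_factor)
  next
    case (step c x y)
    obtain i where i: "i \<in> {1..n}" "x \<in> V i" using step.hyps by blast
    obtain u where u: "\<forall>l\<in>{1..n}. u l \<in> V l" "y = (\<Sum>l=1..n. u l)" using step.IH by blast
    let ?u = "\<lambda>l. (if l = i then c *\<^sub>R x else 0) + u l"
    have "?u l \<in> V l" if l: "l \<in> {1..n}" for l
    proof (rule subspace_add[OF subspace_factor[OF l]])
      show "(if l = i then c *\<^sub>R x else 0) \<in> V l"
        using subspace_mul[OF subspace_factor[OF i(1)] i(2)] subspace_0[OF subspace_factor[OF l]] by simp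
      show "u l \<in> V l" using u(1) l by blast
    qed
    moreover have "c *\<^sub>R x + y = (\<Sum>l=1..n. ?u l)"
      using i u(2) by (simp add: sum.distrib)
    ultimately show ?case by (intro exI[of _ ?u] conjI ballI)
  qed
qed

text \<open>Pairing the difference of the two sums with its own \<open>i\<close>-th component
  removes all other components by orthogonality and leaves the squared norm of that one.\<close>

lemma decomposition_unique:
  assumes "\<And>l. l \<in> {1..n} \<Longrightarrow> u l \<in> V l" "\<And>l. l \<in> {1..n} \<Longrightarrow> v l \<in> V l"
    and eq: "(\<Sum>l=1..n. u l) = (\<Sum>l=1..n. v l)" and i: "i \<in> {1..n}"
  shows "u i = v i"
proof -
  have d: "u l - v l \<in> V l" if "l \<in> {1..n}" for l
    using subspace_factor assms that by (auto intro: subspace_diff)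
  have "0 = (u i - v i) \<bullet> (\<Sum>l=1..n. u l - v l)" using eq by (simp add: sum_subtractf)
  also have "\<dots> = (\<Sum>l=1..n. (u i - v i) \<bullet> (u l - v l))" by (rule inner_sum_right)
  also have "\<dots> = (\<Sum>l=1..n. if l = i then (u i - v i) \<bullet> (u i - v i) else 0)"
    by (intro sum.cong refl) (use orthogonal_factors[OF i _ _ d[OF i] d] in auto)
  also have "\<dots> = (u i - v i) \<bullet> (u i - v i)" using i by simp
  finally show ?thesis by simp
qed

lemma coord_sum_eq:
  assumes "\<And>l. l \<in> {1..n} \<Longrightarrow> u l \<in> V l" and i: "i \<in> {1..n}"
  shows "coord n V i (\<Sum>l=1..n. u l) = u i"
  unfolding coord_def
proof (rule the_equality)
  show "\<exists>v. (\<forall>l\<in>{1..n}. v l \<in> V l) \<and> (\<Sum>l=1..n. u l) = (\<Sum>l=1..n. v l) \<and> u i = v i"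
    by (rule exI[of _ u]) (simp add: assms(1))
  fix y
  assume "\<exists>v. (\<forall>l\<in>{1..n}. v l \<in> V l) \<and> (\<Sum>l=1..n. u l) = (\<Sum>l=1..n. v l) \<and> y = v i"
  then obtain v where "\<forall>l\<in>{1..n}. v l \<in> V l" "(\<Sum>l=1..n. u l) = (\<Sum>l=1..n. v l)" "y = v i"
    by blast
  then show "y = u i" using decomposition_unique[of v u i] assms by auto
qed

lemma coord_in: "i \<in> {1..n} \<Longrightarrow> coord n V i x \<in> V i"
proof -
  assume i: "i \<in> {1..n}"
  obtain u where u: "\<And>l. l \<in> {1..n} \<Longrightarrow> u l \<in> V l" "x = (\<Sum>l=1..n. u l)"
    using decomposition_exists[of x] by blast
  have "coord n V i x = u i" unfolding u(2) using u(1) i by (rule coord_sum_eq)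
  then show ?thesis using u(1)[OF i] by simp
qed

lemma sum_coord: "(\<Sum>i=1..n. coord n V i x) = x"
proof -
  obtain u where u: "\<And>l. l \<in> {1..n} \<Longrightarrow> u l \<in> V l" "x = (\<Sum>l=1..n. u l)"
    using decomposition_exists[of x] by blast
  show ?thesis unfolding u(2) by (intro sum.cong refl coord_sum_eq u(1))
qed

lemma linear_coord:
  assumes i: "i \<in> {1..n}"
  shows "linear (coord n V i)"
proof (rule linearI)
  fix x y :: 'a and c :: real
  have "x + y = (\<Sum>l=1..n. coord n V l x + coord n V l y)"
    by (simp only: sum.distrib sum_coord)
  then show "coord n V i (x + y) = coord n V i x + coord n V i y"
    using coord_sum_eq[of "\<lambda>l. coord n V l x + coord n V l y", OF _ i]
    by (simp add: coord_in subspace_factor subspace_add)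
  have "c *\<^sub>R x = (\<Sum>l=1..n. c *\<^sub>R coord n V l x)"
    by (simp only: sum_coord flip: scaleR_sum_right)
  then show "coord n V i (c *\<^sub>R x) = c *\<^sub>R coord n V i x"
    using coord_sum_eq[of "\<lambda>l. c *\<^sub>R coord n V l x", OF _ i]
    by (simp add: coord_in subspace_factor subspace_mul)
qed

lemma coord_eqI:
  assumes "\<And>i. i \<in> {1..n} \<Longrightarrow> coord n V i x = coord n V i y"
  shows "x = y"
proof -
  have "(\<Sum>i=1..n. coord n V i x) = (\<Sum>i=1..n. coord n V i y)"
    by (intro sum.cong refl assms)
  then show ?thesis by (simp only: sum_coord)
qed

lemma coord_coord:
  assumes "i \<in> {1..n}" "l \<in> {1..n}"
  shows "coord n V i (coord n V l x) = (if i = l then coord n V i x else 0)"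
proof -
  have "coord n V i (\<Sum>j=1..n. if j = l then coord n V l x else 0) = (if i = l then coord n V l x else 0)"
    by (rule coord_sum_eq) (use assms in \<open>auto simp: coord_in subspace_0 subspace_factor\<close>)
  then show ?thesis using assms by simp
qed

lemma sum_norm_coord: "(\<Sum>i=1..n. (norm (coord n V i x))\<^sup>2) = (norm x)\<^sup>2"
proof -
  have "(norm (\<Sum>i=1..n. coord n V i x))\<^sup>2 = (\<Sum>i=1..n. (norm (coord n V i x))\<^sup>2)"
    by (rule norm_sum_Pythagorean)
      (simp, rule pairwiseI, unfold orthogonal_def, rule orthogonal_factors, auto intro: coord_in)
  then show ?thesis by (simp only: sum_coord)
qed

lemma sum_norm_coord_subset:
  assumes "J \<subseteq> {1..n}"
  shows "(norm (\<Sum>i\<in>J. c i *\<^sub>R coord n V i x))\<^sup>2 = (\<Sum>i\<in>J. (c i)\<^sup>2 * (norm (coord n V i x))\<^sup>2)"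
proof -
  have "finite J" using assms finite_subset by blast
  then have "(norm (\<Sum>i\<in>J. c i *\<^sub>R coord n V i x))\<^sup>2 = (\<Sum>i\<in>J. (norm (c i *\<^sub>R coord n V i x))\<^sup>2)"
  proof (rule norm_sum_Pythagorean)
    show "pairwise (\<lambda>i j. orthogonal (c i *\<^sub>R coord n V i x) (c j *\<^sub>R coord n V j x)) J"
    proof (rule pairwiseI)
      fix i j assume "i \<in> J" "j \<in> J" "i \<noteq> j"
      then have "coord n V i x \<bullet> coord n V j x = 0"
        using assms by (intro orthogonal_factors[of i j] coord_in) auto
      then show "orthogonal (c i *\<^sub>R coord n V i x) (c j *\<^sub>R coord n V j x)"
        by (simp add: orthogonal_def)
    qed
  qed
  then show ?thesis by (simp add: power_mult_distrib)
qed

lemma coord_sum_scaled: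
  assumes "J \<subseteq> {1..n}" "i \<in> {1..n}"
  shows "coord n V i (\<Sum>l\<in>J. c l *\<^sub>R coord n V l x) = (if i \<in> J then c i *\<^sub>R coord n V i x else 0)"
proof -
  have "(\<Sum>l\<in>J. c l *\<^sub>R coord n V l x) = (\<Sum>l=1..n. if l \<in> J then c l *\<^sub>R coord n V l x else 0)"
    using assms(1) by (simp add: sum.inter_restrict[symmetric] Int_absorb1)
  then show ?thesis
    using coord_sum_eq[of "\<lambda>l. if l \<in> J then c l *\<^sub>R coord n V l x else 0", OF _ assms(2)]
    by (simp add: coord_in subspace_factor subspace_mul subspace_0)
qed

end

section \<open>The two algorithms as block updates\<close>

lemma power2_norm_Pair: "(norm (x, y))\<^sup>2 = (norm x)\<^sup>2 + (norm y)\<^sup>2"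
  by (simp add: norm_Pair)

text \<open>The common interface of both algorithms. The blocks need not be projections: in
  Algorithm 2 the dual parts overlap, which is why the norm condition is an inequality.\<close>

definition block_resolution :: "nat \<Rightarrow> (nat \<Rightarrow> 'a::euclidean_space \<Rightarrow> 'a) \<Rightarrow> bool" where
  "block_resolution n U \<longleftrightarrow>
     (\<forall>i\<in>{1..n}. linear (U i)) \<and>
     (\<forall>v. (\<Sum>i=1..n. U i v) = v) \<and>
     (\<forall>v. (\<Sum>i=1..n. (norm (U i v))\<^sup>2) \<le> (norm v)\<^sup>2)"

lemma sum_split_blocks: "(\<Sum>i=1..m + p. f i) = (\<Sum>i=1..m. f i) + (\<Sum>j=1..p. f (m + j))"
  for f :: "nat \<Rightarrow> 'b::comm_monoid_add"
proof -
  have "(\<Sum>i=1..m + p. f i) = (\<Sum>i\<in>{1..m} \<union> {m + 1..m + p}. f i)"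
    by (rule sum.cong) auto
  also have "\<dots> = (\<Sum>i=1..m. f i) + (\<Sum>i=m + 1..m + p. f i)"
    by (rule sum.union_disjoint) auto
  also have "(\<Sum>i=m + 1..m + p. f i) = (\<Sum>j=1..p. f (m + j))"
    using sum.shift_bounds_cl_nat_ivl[of f 1 m p] by (simp add: add.commute)
  finally show ?thesis .
qed

lemma dual_neighbours_subset: "dual_neighbours H p G A i \<subseteq> {1..p}"
  by (auto simp: dual_neighbours_def)

text \<open>Double counting of the nonzero blocks of \<open>A\<close>, grouped by columns or by
  rows.\<close>

lemma sum_dual_neighbours:
  "(\<Sum>i=1..m. \<Sum>j\<in>dual_neighbours H p G A i. f i j) = (\<Sum>j=1..p. \<Sum>i\<in>primal_neighbours m H p G A j. f i j)"
  for f :: "nat \<Rightarrow> nat \<Rightarrow> 'b::comm_monoid_add"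
  unfolding dual_neighbours_def primal_neighbours_def by (rule sum.swap_restrict) auto

context
  fixes m p :: nat and H :: "nat \<Rightarrow> 'h::euclidean_space set" and G :: "nat \<Rightarrow> 'g::euclidean_space set"
  assumes H: "hilbert_product m H" and G: "hilbert_product p G"
begin

lemma linear_zcoord:
  assumes "i \<in> {1..m + p}"
  shows "linear (zcoord m H p G i)"
proof (cases "i \<le> m")
  case True
  then have "linear (coord m H i)" using assms by (intro linear_coord H) auto
  note linear_add[OF this] linear_scale[OF this]
  then show ?thesis using True by (intro linearI) (auto simp: zcoord_def)
next
  case False
  then have "linear (coord p G (i - m))" using assms by (intro linear_coord G) auto
  note linear_add[OF this] linear_scale[OF this]
  then show ?thesis using False by (intro linearI) (auto simp: zcoord_def)
qed

lemma sum_zcoord: "(\<Sum>i=1..m + p. zcoord m H p G i z) = z"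
proof -
  have "(\<Sum>i=1..m + p. zcoord m H p G i z)
      = (\<Sum>i=1..m. (coord m H i (fst z), 0)) + (\<Sum>j=1..p. (0, coord p G j (snd z)))"
    unfolding sum_split_blocks by (intro arg_cong2[where f = "(+)"] sum.cong) (auto simp: zcoord_def)
  also have "\<dots> = z"
    by (simp add: prod_eq_iff fst_sum snd_sum sum_coord[OF H] sum_coord[OF G] del: One_nat_def)
  finally show ?thesis .
qed

lemma sum_norm_zcoord: "(\<Sum>i=1..m + p. (norm (zcoord m H p G i z))\<^sup>2) = (norm z)\<^sup>2"
proof -
  have "(\<Sum>i=1..m + p. (norm (zcoord m H p G i z))\<^sup>2)
      = (\<Sum>i=1..m. (norm (coord m H i (fst z)))\<^sup>2) + (\<Sum>j=1..p. (norm (coord p G j (snd z)))\<^sup>2)"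
    unfolding sum_split_blocks by (intro arg_cong2[where f = "(+)"] sum.cong) (auto simp: zcoord_def norm_Pair)
  also have "\<dots> = (norm z)\<^sup>2"
    by (cases z) (simp add: sum_norm_coord[OF H] sum_norm_coord[OF G] norm_Pair del: One_nat_def)
  finally show ?thesis .
qed

lemma zcoord_eqI:
  assumes "\<And>i. i \<in> {1..m + p} \<Longrightarrow> zcoord m H p G i z = zcoord m H p G i w"
  shows "z = w"
proof -
  have "(\<Sum>i=1..m + p. zcoord m H p G i z) = (\<Sum>i=1..m + p. zcoord m H p G i w)"
    by (intro sum.cong refl assms)
  then show ?thesis by (simp only: sum_zcoord)
qed

lemma zcoord_zcoord:
  assumes "i \<in> {1..m + p}" "l \<in> {1..m + p}"
  shows "zcoord m H p G i (zcoord m H p G l z) = (if i = l then zcoord m H p G i z else 0)"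
proof -
  have H0: "coord m H i 0 = 0" if "i \<le> m"
    using assms(1) that by (intro linear_0 linear_coord H) auto
  have G0: "coord p G (i - m) 0 = 0" if "\<not> i \<le> m"
    using assms(1) that by (intro linear_0 linear_coord G) auto
  have HH: "coord m H i (coord m H l x) = (if i = l then coord m H i x else 0)" if "i \<le> m" "l \<le> m" for x
    using assms that by (intro coord_coord H) auto
  have "coord p G (i - m) (coord p G (l - m) x) = (if i - m = l - m then coord p G (i - m) x else 0)"
    if "\<not> i \<le> m" "\<not> l \<le> m" for x
    using assms that by (intro coord_coord G) auto
  \<comment> \<open>Truncated subtraction of \<open>m\<close> is injective here because both indices
    exceed \<open>m\<close>.\<close>
  then have GG: "coord p G (i - m) (coord p G (l - m) x) = (if i = l then coord p G (i - m) x else 0)"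
    if "\<not> i \<le> m" "\<not> l \<le> m" for x
    using that by auto
  show ?thesis
    by (cases "i \<le> m"; cases "l \<le> m") (auto simp: zcoord_def HH GG H0 G0 zero_prod_def)
qed

lemma block_resolution_zcoord: "block_resolution (m + p) (zcoord m H p G)"
  unfolding block_resolution_def by (simp add: linear_zcoord sum_zcoord sum_norm_zcoord del: One_nat_def)

lemma algorithm1_update:
  assumes "algorithm1 m H p G T q step idx zhat z" and idx: "idx k \<in> {1..m + p}"
  shows "z (Suc k) = z k - (step k / (real (m + p) * q (idx k))) *\<^sub>R
    zcoord m H p G (idx k) (zhat k - T (zhat k))"
proof (rule zcoord_eqI)
  fix i assume i: "i \<in> {1..m + p}"
  note lin = linear_diff[OF linear_zcoord[OF i]] linear_scale[OF linear_zcoord[OF i]]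
  show "zcoord m H p G i (z (Suc k)) = zcoord m H p G i (z k - (step k / (real (m + p) * q (idx k))) *\<^sub>R
      zcoord m H p G (idx k) (zhat k - T (zhat k)))"
    using assms(1) i idx unfolding algorithm1_def lin zcoord_zcoord[OF i idx]
    by (auto simp: linear_diff[OF linear_zcoord[OF idx]])
qed

definition overlapping_block ::
  "('h \<Rightarrow> 'g) \<Rightarrow> (nat \<Rightarrow> nat \<Rightarrow> real) \<Rightarrow> nat \<Rightarrow> 'h \<times> 'g \<Rightarrow> 'h \<times> 'g" where
  "overlapping_block A \<rho> i z =
     (coord m H i (fst z), \<Sum>j\<in>dual_neighbours H p G A i. \<rho> i j *\<^sub>R coord p G j (snd z))"

text \<open>For each dual coordinate the shares \<open>\<rho> i j\<close> add up to one, so the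
  pieces reassemble it. Being nonnegative, the shares lie in [0, 1]; hence their squares sum to at
  most one, which gives the norm condition.\<close>

lemma block_resolution_overlapping:
  assumes "overlapping_setting m H p G g h A \<rho>"
  shows "block_resolution m (overlapping_block A \<rho>)"
  unfolding block_resolution_def
proof (intro conjI ballI allI)
  have rho_nn: "0 \<le> \<rho> i j" if "i \<in> {1..m}" "j \<in> {1..p}" for i j
    using assms that by (simp add: overlapping_setting_def)
  have rho_sum: "(\<Sum>i\<in>primal_neighbours m H p G A j. \<rho> i j) = 1" if "j \<in> {1..p}" for j
    using assms that by (simp add: overlapping_setting_def)
  have fin: "finite (primal_neighbours m H p G A j)" for j by (simp add: primal_neighbours_def)
  fix z :: "'h \<times> 'g"
  have "(\<Sum>i=1..m. \<Sum>j\<in>dual_neighbours H p G A i. \<rho> i j *\<^sub>R coord p G j (snd z)) = snd z"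
    unfolding sum_dual_neighbours
    by (simp add: rho_sum sum_coord[OF G] del: One_nat_def flip: scaleR_sum_left)
  then show "(\<Sum>i=1..m. overlapping_block A \<rho> i z) = z"
    by (simp add: prod_eq_iff fst_sum snd_sum overlapping_block_def sum_coord[OF H] del: One_nat_def)
  have "(\<Sum>i=1..m. (norm (overlapping_block A \<rho> i z))\<^sup>2)
      = (\<Sum>i=1..m. (norm (coord m H i (fst z)))\<^sup>2)
        + (\<Sum>i=1..m. \<Sum>j\<in>dual_neighbours H p G A i. (\<rho> i j)\<^sup>2 * (norm (coord p G j (snd z)))\<^sup>2)"
    by (simp only: overlapping_block_def power2_norm_Pair sum_norm_coord_subset[OF G dual_neighbours_subset] sum.distrib)
  also have "\<dots> \<le> (norm (fst z))\<^sup>2 + (norm (snd z))\<^sup>2"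
  proof (rule add_mono)
    have "(\<Sum>i\<in>primal_neighbours m H p G A j. (\<rho> i j)\<^sup>2) \<le> 1" if j: "j \<in> {1..p}" for j
    proof -
      have "(\<rho> i j)\<^sup>2 \<le> \<rho> i j" if "i \<in> primal_neighbours m H p G A j" for i
      proof -
        have nn: "0 \<le> \<rho> l j" if "l \<in> primal_neighbours m H p G A j" for l
          using that j rho_nn by (auto simp: primal_neighbours_def)
        have "\<rho> i j \<le> (\<Sum>i\<in>primal_neighbours m H p G A j. \<rho> i j)"
          by (rule member_le_sum) (use that nn fin in auto)
        then show ?thesis
          using nn[OF that] rho_sum[OF j] by (simp add: power2_eq_square mult_left_le)
      qed
      then have "(\<Sum>i\<in>primal_neighbours m H p G A j. (\<rho> i j)\<^sup>2) \<le> (\<Sum>i\<in>primal_neighbours m H p G A j. \<rho> i j)"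
        by (rule sum_mono)
      then show ?thesis using rho_sum[OF j] by simp
    qed
    then have "(\<Sum>j=1..p. (\<Sum>i\<in>primal_neighbours m H p G A j. (\<rho> i j)\<^sup>2) * (norm (coord p G j (snd z)))\<^sup>2)
        \<le> (\<Sum>j=1..p. 1 * (norm (coord p G j (snd z)))\<^sup>2)"
      by (intro sum_mono mult_right_mono) auto
    then show "(\<Sum>i=1..m. \<Sum>j\<in>dual_neighbours H p G A i. (\<rho> i j)\<^sup>2 * (norm (coord p G j (snd z)))\<^sup>2)
        \<le> (norm (snd z))\<^sup>2"
      unfolding sum_dual_neighbours by (simp add: sum_norm_coord[OF G] del: One_nat_def flip: sum_distrib_right)
  qed (simp add: sum_norm_coord[OF H] del: One_nat_def)
  also have "\<dots> = (norm z)\<^sup>2" by (cases z) (simp add: norm_Pair)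
  finally show "(\<Sum>i=1..m. (norm (overlapping_block A \<rho> i z))\<^sup>2) \<le> (norm z)\<^sup>2" .
next
  fix i assume i: "i \<in> {1..m}"
  note lin_H = linear_add[OF linear_coord[OF H i]] linear_scale[OF linear_coord[OF H i]]
  have lin_G: "coord p G j (x + y) = coord p G j x + coord p G j y"
    "coord p G j (c *\<^sub>R x) = c *\<^sub>R coord p G j x" if "j \<in> dual_neighbours H p G A i" for j x y c
    using linear_add[OF linear_coord[OF G]] linear_scale[OF linear_coord[OF G]] that dual_neighbours_subset
    by blast+
  show "linear (overlapping_block A \<rho> i)"
    by (rule linearI) (auto simp: overlapping_block_def lin_H lin_G scaleR_add_right sum.distrib
        scaleR_sum_right mult.commute cong: sum.cong)
qed

lemma algorithm2_update:
  assumes "algorithm2 m H p G A \<rho> T q step idx zhat z" and idx: "idx k \<in> {1..m}"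
  shows "z (Suc k) = z k - (step k / (real m * q (idx k))) *\<^sub>R
    overlapping_block A \<rho> (idx k) (zhat k - T (zhat k))" (is "_ = z k - ?c *\<^sub>R ?u")
proof (rule prod_eqI)
  show "fst (z (Suc k)) = fst (z k - ?c *\<^sub>R ?u)"
  proof (rule coord_eqI[OF H])
    fix i assume i: "i \<in> {1..m}"
    note lin = linear_diff[OF linear_coord[OF H i]] linear_scale[OF linear_coord[OF H i]]
    have "coord m H i (fst (z (Suc k))) =
        coord m H i (fst (z k)) - ?c *\<^sub>R (if i = idx k then coord m H i (fst (zhat k - T (zhat k))) else 0)"
      using assms(1) i unfolding algorithm2_def by (cases "i = idx k") simp_all
    then show "coord m H i (fst (z (Suc k))) = coord m H i (fst (z k - ?c *\<^sub>R ?u))"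
      by (simp only: overlapping_block_def fst_diff fst_scaleR fst_conv lin coord_coord[OF H i idx])
  qed
  show "snd (z (Suc k)) = snd (z k - ?c *\<^sub>R ?u)"
  proof (rule coord_eqI[OF G])
    fix j assume j: "j \<in> {1..p}"
    note lin = linear_diff[OF linear_coord[OF G j]] linear_scale[OF linear_coord[OF G j]]
    have "coord p G j (snd (z (Suc k))) = coord p G j (snd (z k))
        - ?c *\<^sub>R (if j \<in> dual_neighbours H p G A (idx k)
                then \<rho> (idx k) j *\<^sub>R coord p G j (snd (zhat k - T (zhat k))) else 0)"
      using assms(1) j unfolding algorithm2_def
      by (cases "j \<in> dual_neighbours H p G A (idx k)") (simp_all add: mult.commute)
    then show "coord p G j (snd (z (Suc k))) = coord p G j (snd (z k - ?c *\<^sub>R ?u))"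
      by (simp only: overlapping_block_def snd_diff snd_scaleR snd_conv lin
          coord_sum_scaled[OF G dual_neighbours_subset j])
  qed
qed

end

section \<open>Almost sure convergence of nonnegative supermartingales\<close>

lemma (in prob_space) integrable_bounded:
  fixes f :: "'a \<Rightarrow> real"
  assumes "f \<in> borel_measurable M" "\<And>\<omega>. \<omega> \<in> space M \<Longrightarrow> \<bar>f \<omega>\<bar> \<le> B"
  shows "integrable M f"
  by (rule integrable_const_bound[of _ B]) (use assms in \<open>auto intro: AE_I2\<close>)

text \<open>By monotone convergence the series has finite expectation, so it converges almost
  surely. This serves twice: for the residuals, and for the indicators of upcrossings, where a null
  sequence of zeros and ones is eventually zero.\<close>

lemma (in prob_space) AE_tendsto_0_if_integral_sum_bounded:
  fixes V :: "nat \<Rightarrow> 'a \<Rightarrow> real"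
  assumes int: "\<And>k. integrable M (V k)" and nn: "\<And>k \<omega>. \<omega> \<in> space M \<Longrightarrow> 0 \<le> V k \<omega>"
    and bound: "\<And>n. (\<Sum>k<n. expectation (V k)) \<le> C"
  shows "AE \<omega> in M. (\<lambda>k. V k \<omega>) \<longlonglongrightarrow> 0"
proof -
  have meas [measurable]: "V k \<in> borel_measurable M" for k using int by auto
  have "(\<integral>\<^sup>+ \<omega>. (\<Sum>k. ennreal (V k \<omega>)) \<partial>M) = (\<Sum>k. \<integral>\<^sup>+ \<omega>. ennreal (V k \<omega>) \<partial>M)"
    by (intro nn_integral_suminf) simp
  also have "\<dots> = (\<Sum>k. ennreal (expectation (V k)))"
    by (intro suminf_cong nn_integral_eq_integral int AE_I2 nn)
  also have "\<dots> \<le> ennreal C"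
  proof (rule suminf_le_const)
    show "summable (\<lambda>k. ennreal (expectation (V k)))" by simp
    have "0 \<le> expectation (V k)" for k by (intro integral_nonneg_AE AE_I2 nn)
    then show "(\<Sum>k<n. ennreal (expectation (V k))) \<le> ennreal C" for n
      using bound[of n] by (simp add: sum_ennreal ennreal_leI)
  qed
  finally have "(\<integral>\<^sup>+ \<omega>. (\<Sum>k. ennreal (V k \<omega>)) \<partial>M) \<noteq> \<infinity>"
    by (auto simp: top_unique)
  then have "AE \<omega> in M. (\<Sum>k. ennreal (V k \<omega>)) \<noteq> \<infinity>"
    by (intro nn_integral_PInf_AE) simp_all
  then show ?thesis
  proof (rule AE_mp, intro AE_I2 impI)
    fix \<omega> assume \<omega>: "\<omega> \<in> space M" and fin: "(\<Sum>k. ennreal (V k \<omega>)) \<noteq> \<infinity>"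
    have "summable (\<lambda>k. V k \<omega>)"
      by (rule summable_suminf_not_top) (use fin nn[OF \<omega>] in auto)
    then show "(\<lambda>k. V k \<omega>) \<longlonglongrightarrow> 0" by (rule summable_LIMSEQ_zero)
  qed
qed

text \<open>
  Doob's trading strategy: buy when the price \<open>Y\<close> is at most \<open>a\<close>, sell when it is at least \<open>b\<close>.
  Each sale completes an upcrossing of \<open>[a, b]\<close> and gains at least \<open>b - a\<close>, while the expected
  total gain on a supermartingale is at most \<open>0\<close>.
\<close>

primrec holding :: "real \<Rightarrow> real \<Rightarrow> (nat \<Rightarrow> real) \<Rightarrow> nat \<Rightarrow> bool" where
  "holding a b Y 0 \<longleftrightarrow> Y 0 \<le> a"
| "holding a b Y (Suc k) \<longleftrightarrow> (if holding a b Y k then Y (Suc k) < b else Y (Suc k) \<le> a)"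

definition upcrossing :: "real \<Rightarrow> real \<Rightarrow> (nat \<Rightarrow> real) \<Rightarrow> nat \<Rightarrow> bool" where
  "upcrossing a b Y k \<longleftrightarrow> holding a b Y k \<and> b \<le> Y (Suc k)"

text \<open>The second summand on the left is the book value of an open position relative to the
  purchase bound \<open>a\<close>; it carries the induction through the periods between
  sales.\<close>

lemma gain_ge_upcrossings:
  "(b - a) * (\<Sum>k<n. of_bool (upcrossing a b Y k)) + (if holding a b Y n then Y n - a else 0)
    \<le> (\<Sum>k<n. of_bool (holding a b Y k) * (Y (Suc k) - Y k))"
proof (induction n)
  case (Suc n)
  then show ?case by (auto simp: upcrossing_def algebra_simps split: if_splits)
qed auto

text \<open>After the last upcrossing nothing is sold. Either a position is held from some time on,
  and the price stays below \<open>b\<close>, or nothing is bought any more, and it stays above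
  \<open>a\<close>.\<close>

lemma finitely_many_upcrossings:
  assumes "\<forall>\<^sub>F k in sequentially. \<not> upcrossing a b Y k"
  shows "(\<forall>\<^sub>F k in sequentially. Y k < b) \<or> (\<forall>\<^sub>F k in sequentially. a < Y k)"
proof -
  obtain N where N: "\<And>k. k \<ge> N \<Longrightarrow> \<not> upcrossing a b Y k"
    using assms by (auto simp: eventually_sequentially)
  show ?thesis
  proof (cases "\<exists>n\<ge>N. holding a b Y n")
    case True
    then obtain n where n: "n \<ge> N" "holding a b Y n" by blast
    have hold: "holding a b Y k" if "k \<ge> n" for k
      using that
    proof (induction k rule: dec_induct)
      case (step k)
      then show ?case using N[of k] n(1) by (simp add: upcrossing_def)
    qed (rule n)
    have "Y k < b" if "k \<ge> Suc n" for k
    proof (cases k)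
      case (Suc l)
      then show ?thesis using hold[of l] hold[of k] that by simp
    qed (use that in simp)
    then show ?thesis by (auto simp: eventually_sequentially)
  next
    case False
    have "a < Y k" if "k \<ge> Suc N" for k
    proof (cases k)
      case (Suc l)
      then have "N \<le> l" "N \<le> Suc l" using that by simp_all
      then have "\<not> holding a b Y l" "\<not> holding a b Y (Suc l)" using False by blast+
      then show ?thesis using Suc by simp
    qed (use that in simp)
    then show ?thesis by (auto simp: eventually_sequentially)
  qed
qed

text \<open>Absence of oscillation still permits divergence to infinity; the condition on the liminf
  excludes it.\<close>

lemma convergent_if_no_oscillation:
  fixes Y :: "nat \<Rightarrow> real"
  assumes nn: "\<And>k. 0 \<le> Y k"
    and osc: "\<And>a b. a \<in> \<rat> \<Longrightarrow> b \<in> \<rat> \<Longrightarrow> 0 < a \<Longrightarrow> a < b \<Longrightarrow>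
      (\<forall>\<^sub>F k in sequentially. Y k < b) \<or> (\<forall>\<^sub>F k in sequentially. a < Y k)"
    and fin: "liminf (\<lambda>k. ennreal (Y k)) \<noteq> \<infinity>"
  shows "convergent Y"
proof -
  let ?i = "liminf (\<lambda>k. ereal (Y k))" and ?s = "limsup (\<lambda>k. ereal (Y k))"
  have i0: "0 \<le> ?i" by (intro Liminf_bounded always_eventually) (simp add: nn)
  have "?i \<noteq> \<infinity>"
  proof
    assume i: "?i = \<infinity>"
    obtain c where c: "0 \<le> c" "liminf (\<lambda>k. ennreal (Y k)) = ennreal c"
      using fin by (cases "liminf (\<lambda>k. ennreal (Y k))") auto
    have "\<forall>\<^sub>F k in sequentially. ereal (c + 1) < ereal (Y k)"
      by (rule less_LiminfD) (simp add: i)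
    then have "ennreal (c + 1) \<le> liminf (\<lambda>k. ennreal (Y k))"
      by (intro Liminf_bounded) (auto elim!: eventually_mono intro: ennreal_leI)
    then show False using c by (simp add: ennreal_le_iff)
  qed
  have "\<not> ?i < ?s"
  proof
    assume less: "?i < ?s"
    \<comment> \<open>\<open>?i\<close> and \<open>?s\<close> are extended reals, so real numbers
      \<open>a1 < a0 < b0\<close> are inserted strictly between them to make room for rational
      \<open>a < b\<close>. Positivity of \<open>a\<close> comes from
      \<open>0 \<le> ?i\<close>.\<close>
    then obtain a0 where a0: "?i < ereal a0" "ereal a0 < ?s" using ereal_dense2 by blast
    then obtain b0 where b0: "ereal a0 < ereal b0" "ereal b0 < ?s" using ereal_dense2 by blast
    obtain b where b: "b \<in> \<rat>" "a0 < b" "b < b0" using Rats_dense_in_real[of a0 b0] b0 by auto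
    obtain a1 where a1: "?i < ereal a1" "ereal a1 < ereal a0" using ereal_dense2[OF a0(1)] by blast
    obtain a where a: "a \<in> \<rat>" "a1 < a" "a < a0" using Rats_dense_in_real[of a1 a0] a1 by auto
    have "0 < ereal a1" using i0 a1(1) by (rule le_less_trans)
    then have "0 < a" "a < b" using a b by auto
    then consider "\<forall>\<^sub>F k in sequentially. Y k < b" | "\<forall>\<^sub>F k in sequentially. a < Y k"
      using osc a(1) b(1) by blast
    then show False
    proof cases
      case 1
      then have "?s \<le> ereal b" by (intro Limsup_bounded) (auto elim: eventually_mono)
      moreover have "ereal b < ereal b0" using b by simp
      ultimately show False using b0(2) by (metis less_le_trans less_asym le_less_trans)
    next
      case 2
      then have "ereal a \<le> ?i" by (intro Liminf_bounded) (auto elim: eventually_mono)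
      moreover have "ereal a1 < ereal a" using a by simp
      ultimately show False using a1(1) by (metis less_le_trans less_asym)
    qed
  qed
  then have eq: "?i = ?s" using Liminf_le_Limsup[of sequentially "\<lambda>k. ereal (Y k)"] by auto
  obtain l where "?i = ereal l" using i0 \<open>?i \<noteq> \<infinity>\<close> by (cases ?i) auto
  then have "(\<lambda>k. ereal (Y k)) \<longlonglongrightarrow> ereal l"
    using eq by (intro Liminf_eq_Limsup) auto
  then show ?thesis by (auto simp: convergent_def)
qed

text \<open>\<open>descent\<close> is the drift condition E[Y_(k+1) | F_k] \<le> Y_k - V_k in
  integrated form. It will be tested on two kinds of events: the whole space, and the holding events
  of the trading strategy.\<close>

locale nonneg_supermartingale = prob_space M for M :: "'w measure" +
  fixes F :: "nat \<Rightarrow> 'w measure" and Y V :: "nat \<Rightarrow> 'w \<Rightarrow> real"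
  assumes space_F: "space (F k) = space M"
    and F_M: "sets (F k) \<subseteq> sets M"
    and F_Suc: "sets (F k) \<subseteq> sets (F (Suc k))"
    and Y_F: "Y k \<in> borel_measurable (F k)"
    and Y_int: "integrable M (Y k)" and V_int: "integrable M (V k)"
    and Y_nn: "\<omega> \<in> space M \<Longrightarrow> 0 \<le> Y k \<omega>" and V_nn: "\<omega> \<in> space M \<Longrightarrow> 0 \<le> V k \<omega>"
    and descent: "B \<in> sets (F k) \<Longrightarrow>
      (\<integral>\<omega>. indicator B \<omega> * Y (Suc k) \<omega> \<partial>M) \<le> (\<integral>\<omega>. indicator B \<omega> * (Y k \<omega> - V k \<omega>) \<partial>M)"
begin

lemma Y_mono: "(\<Sum>k<n. expectation (V k)) + expectation (Y n) \<le> expectation (Y 0)"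
proof (induction n)
  case (Suc n)
  have "(\<integral>\<omega>. indicator (space M) \<omega> * Y (Suc n) \<omega> \<partial>M)
      \<le> (\<integral>\<omega>. indicator (space M) \<omega> * (Y n \<omega> - V n \<omega>) \<partial>M)"
    using sets.top[of "F n"] by (intro descent) (simp add: space_F)
  also have "(\<integral>\<omega>. indicator (space M) \<omega> * Y (Suc n) \<omega> \<partial>M) = expectation (Y (Suc n))"
    by (intro Bochner_Integration.integral_cong) auto
  also have "(\<integral>\<omega>. indicator (space M) \<omega> * (Y n \<omega> - V n \<omega>) \<partial>M) = (\<integral>\<omega>. Y n \<omega> - V n \<omega> \<partial>M)"
    by (intro Bochner_Integration.integral_cong) auto
  also have "\<dots> = expectation (Y n) - expectation (V n)"
    by (intro Bochner_Integration.integral_diff Y_int V_int)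
  finally show ?case using Suc.IH by simp
qed simp

lemma expectation_nonneg: "0 \<le> expectation (Y n)" "0 \<le> expectation (V n)"
  by (intro integral_nonneg_AE AE_I2 Y_nn V_nn; assumption)+

lemma AE_V_tendsto_0: "AE \<omega> in M. (\<lambda>k. V k \<omega>) \<longlonglongrightarrow> 0"
proof (rule AE_tendsto_0_if_integral_sum_bounded[OF V_int V_nn])
  show "(\<Sum>k<n. expectation (V k)) \<le> expectation (Y 0)" for n
    using Y_mono[of n] expectation_nonneg(1)[of n] by linarith
qed

text \<open>Whether a position is held from \<open>k\<close> to \<open>Suc k\<close> is decided by
  the prices up to \<open>k\<close>, so the event is admissible in \<open>descent\<close>.\<close>

lemma holding_F: "{\<omega> \<in> space M. holding a b (\<lambda>k. Y k \<omega>) k} \<in> sets (F k)"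
proof (induction k)
  case 0
  have "{\<omega> \<in> space (F 0). Y 0 \<omega> \<le> a} \<in> sets (F 0)" using Y_F by measurable
  then show ?case by (simp add: space_F)
next
  case (Suc k)
  let ?H = "{\<omega> \<in> space M. holding a b (\<lambda>k. Y k \<omega>) k}"
  have 1: "{\<omega> \<in> space (F (Suc k)). Y (Suc k) \<omega> < b} \<in> sets (F (Suc k))"
    and 2: "{\<omega> \<in> space (F (Suc k)). Y (Suc k) \<omega> \<le> a} \<in> sets (F (Suc k))"
    using Y_F by measurable
  have "{\<omega> \<in> space M. holding a b (\<lambda>k. Y k \<omega>) (Suc k)} =
      (?H \<inter> {\<omega> \<in> space (F (Suc k)). Y (Suc k) \<omega> < b}) \<union> ({\<omega> \<in> space (F (Suc k)). Y (Suc k) \<omega> \<le> a} - ?H)"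
    by (auto simp: space_F split: if_splits)
  moreover have "?H \<in> sets (F (Suc k))" using Suc F_Suc by blast
  ultimately show ?case using 1 2 by (simp only: sets.Un sets.Int sets.Diff)
qed

text \<open>Doob's upcrossing inequality: since \<open>Y\<close> is nonnegative, a position still
  open is worth at least \<open>- a\<close> in the book, so the expected number of upcrossings is at
  most \<open>a / (b - a)\<close>, uniformly in time.\<close>

lemma AE_finitely_many_upcrossings:
  assumes "0 < a" "a < b"
  shows "AE \<omega> in M. \<forall>\<^sub>F k in sequentially. \<not> upcrossing a b (\<lambda>k. Y k \<omega>) k"
proof -
  let ?H = "\<lambda>k. {\<omega> \<in> space M. holding a b (\<lambda>k. Y k \<omega>) k}"
  let ?u = "\<lambda>k \<omega>. of_bool (upcrossing a b (\<lambda>k. Y k \<omega>) k) :: real"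
  have [measurable]: "Y k \<in> borel_measurable M" for k using Y_int by auto
  have H [measurable]: "?H k \<in> sets M" for k using holding_F F_M by blast
  have "?u k \<in> borel_measurable M" for k
  proof -
    have "{\<omega> \<in> space M. b \<le> Y (Suc k) \<omega>} \<inter> ?H k \<in> sets M" by measurable
    then have "indicator ({\<omega> \<in> space M. b \<le> Y (Suc k) \<omega>} \<inter> ?H k) \<in> borel_measurable M"
      by (rule borel_measurable_indicator)
    then show ?thesis
      by (rule measurable_cong[THEN iffD1, rotated])
        (auto simp: upcrossing_def indicator_def split: if_splits)
  qed
  then have u: "integrable M (?u k)" for k by (rule integrable_bounded[of _ 1]) auto
  have gain: "integrable M (\<lambda>\<omega>. indicator (?H k) \<omega> * (Y (Suc k) \<omega> - Y k \<omega>))"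
      (is "integrable M (?g k)") for k
    using integrable_real_mult_indicator[OF H[of k], of "\<lambda>\<omega>. Y (Suc k) \<omega> - Y k \<omega>"] Y_int
    by (simp add: mult.commute)
  have gain_le: "expectation (?g k) \<le> 0" for k
  proof -
    have ind_int: "integrable M (\<lambda>\<omega>. indicator (?H k) \<omega> * f \<omega>)" if "integrable M f" for f :: "'w \<Rightarrow> real"
      using integrable_real_mult_indicator[OF H[of k] that] by (simp add: mult.commute)
    have "expectation (?g k) = (\<integral>\<omega>. indicator (?H k) \<omega> * Y (Suc k) \<omega> \<partial>M) - (\<integral>\<omega>. indicator (?H k) \<omega> * Y k \<omega> \<partial>M)"
      unfolding right_diff_distrib by (intro Bochner_Integration.integral_diff ind_int Y_int)
    also have "\<dots> \<le> (\<integral>\<omega>. indicator (?H k) \<omega> * (Y k \<omega> - V k \<omega>) \<partial>M) - (\<integral>\<omega>. indicator (?H k) \<omega> * Y k \<omega> \<partial>M)"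
      using descent[OF holding_F] by simp
    also have "\<dots> = - (\<integral>\<omega>. indicator (?H k) \<omega> * V k \<omega> \<partial>M)"
      unfolding right_diff_distrib
      by (subst Bochner_Integration.integral_diff) (auto intro: ind_int Y_int V_int)
    also have "\<dots> \<le> 0" by (simp, intro integral_nonneg_AE AE_I2) (simp add: V_nn)
    finally show ?thesis .
  qed
  have "AE \<omega> in M. (\<lambda>k. ?u k \<omega>) \<longlonglongrightarrow> 0"
  proof (rule AE_tendsto_0_if_integral_sum_bounded[OF u])
    fix n
    have "(b - a) * (\<Sum>k<n. ?u k \<omega>) \<le> (\<Sum>k<n. ?g k \<omega>) + a" if "\<omega> \<in> space M" for \<omega>
    proof -
      have "(of_bool (holding a b (\<lambda>k. Y k \<omega>) k) :: real) = indicator (?H k) \<omega>" for k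
        using that by (auto simp: indicator_def)
      note this [symmetric]
      moreover have "- a \<le> (if holding a b (\<lambda>k. Y k \<omega>) n then Y n \<omega> - a else 0)"
        using Y_nn[OF that, of n] assms by auto
      ultimately show ?thesis
        using gain_ge_upcrossings[of b a "\<lambda>k. Y k \<omega>" n] by simp
    qed
    then have "(\<integral>\<omega>. (b - a) * (\<Sum>k<n. ?u k \<omega>) \<partial>M) \<le> (\<integral>\<omega>. (\<Sum>k<n. ?g k \<omega>) + a \<partial>M)"
      by (intro integral_mono Bochner_Integration.integrable_add Bochner_Integration.integrable_sum
          Bochner_Integration.integrable_mult_right u gain integrable_const)
    also have "(\<integral>\<omega>. (b - a) * (\<Sum>k<n. ?u k \<omega>) \<partial>M) = (b - a) * (\<Sum>k<n. expectation (?u k))"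
      by (subst integral_mult_right_zero, subst Bochner_Integration.integral_sum) (rule u refl)+
    also have "(\<integral>\<omega>. (\<Sum>k<n. ?g k \<omega>) + a \<partial>M) = (\<Sum>k<n. expectation (?g k)) + a"
      by (subst Bochner_Integration.integral_add, intro Bochner_Integration.integrable_sum gain, rule integrable_const,
          subst Bochner_Integration.integral_sum, rule gain) (simp add: prob_space)
    also have "\<dots> \<le> 0 + a" by (intro add_right_mono sum_nonpos gain_le)
    finally show "(\<Sum>k<n. expectation (?u k)) \<le> a / (b - a)"
      using assms by (simp add: field_simps)
  qed simp
  then show ?thesis
  proof (rule AE_mp, intro AE_I2 impI)
    fix \<omega> assume "(\<lambda>k. ?u k \<omega>) \<longlonglongrightarrow> 0"
    then have "\<forall>\<^sub>F k in sequentially. ?u k \<omega> < 1" by (rule order_tendstoD) simp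
    then show "\<forall>\<^sub>F k in sequentially. \<not> upcrossing a b (\<lambda>k. Y k \<omega>) k"
      by (rule eventually_mono) (auto split: if_splits)
  qed
qed

text \<open>Fatou's lemma makes the liminf finite almost surely; restricting the levels to rational
  pairs leaves only countably many exceptional null sets.\<close>

lemma AE_convergent: "AE \<omega> in M. convergent (\<lambda>k. Y k \<omega>)"
proof -
  have [measurable]: "Y k \<in> borel_measurable M" for k using Y_int by auto
  have "(\<integral>\<^sup>+ \<omega>. liminf (\<lambda>k. ennreal (Y k \<omega>)) \<partial>M) \<le> liminf (\<lambda>k. \<integral>\<^sup>+ \<omega>. ennreal (Y k \<omega>) \<partial>M)"
    by (intro nn_integral_liminf) simp
  also have "\<dots> = liminf (\<lambda>k. ennreal (expectation (Y k)))"
    by (intro arg_cong[where f = liminf] ext nn_integral_eq_integral Y_int AE_I2 Y_nn)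
  also have "\<dots> \<le> liminf (\<lambda>k. ennreal (expectation (Y 0)))"
  proof (intro Liminf_mono always_eventually allI ennreal_leI)
    fix n show "expectation (Y n) \<le> expectation (Y 0)"
      using Y_mono[of n] sum_nonneg[of "{..<n}" "\<lambda>k. expectation (V k)"] expectation_nonneg(2) by simp
  qed
  also have "\<dots> < \<infinity>" by (simp add: Liminf_const)
  finally have "(\<integral>\<^sup>+ \<omega>. liminf (\<lambda>k. ennreal (Y k \<omega>)) \<partial>M) \<noteq> \<infinity>" by simp
  then have fin: "AE \<omega> in M. liminf (\<lambda>k. ennreal (Y k \<omega>)) \<noteq> \<infinity>"
    by (intro nn_integral_PInf_AE) simp_all
  have "AE \<omega> in M. \<forall>a\<in>\<rat>. \<forall>b\<in>\<rat>. 0 < a \<and> a < b \<longrightarrow>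
      (\<forall>\<^sub>F k in sequentially. \<not> upcrossing a b (\<lambda>k. Y k \<omega>) k)"
    using AE_finitely_many_upcrossings by (auto simp: AE_ball_countable[OF countable_rat])
  with fin AE_space show ?thesis
  proof eventually_elim
    case (elim \<omega>)
    show ?case
    proof (rule convergent_if_no_oscillation)
      show "0 \<le> Y k \<omega>" for k using elim by (simp add: Y_nn)
      show "(\<forall>\<^sub>F k in sequentially. Y k \<omega> < b) \<or> (\<forall>\<^sub>F k in sequentially. a < Y k \<omega>)"
        if "a \<in> \<rat>" "b \<in> \<rat>" "0 < a" "a < b" for a b
        by (rule finitely_many_upcrossings) (use elim that in blast)
    qed (use elim in blast)
  qed
qed

end

section \<open>Nonexpansive operators in the metric of a positive definite matrix\<close>

text \<open>\<open>lo\<close> and \<open>hi\<close> compare the metric of \<open>M\<close> with the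
  Euclidean one. They will be the extreme eigenvalues, so that \<open>hi / lo\<close> becomes the
  condition number.\<close>

locale nonexpansive_operator = symmetric_operator M for M :: "'a::euclidean_space \<Rightarrow> 'a" +
  fixes T :: "'a \<Rightarrow> 'a" and lo hi :: real
  assumes lo_pos: "0 < lo"
    and lower: "lo * (norm x)\<^sup>2 \<le> x \<bullet> M x" and upper: "x \<bullet> M x \<le> hi * (norm x)\<^sup>2"
    and nonexpansive: "(T x - T y) \<bullet> M (T x - T y) \<le> (x - y) \<bullet> M (x - y)"
begin

definition N :: "'a \<Rightarrow> real" where "N x = x \<bullet> M x"

definition S :: "'a \<Rightarrow> 'a" where "S x = x - T x"

lemmas M_linear = linear_add[OF linear_M] linear_diff[OF linear_M] linear_scale[OF linear_M]
  linear_neg[OF linear_M] linear_sum[OF linear_M] linear_0[OF linear_M]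

lemma N_nonneg: "0 \<le> N x"
  using lower[of x] lo_pos unfolding N_def by (smt (verit) mult_nonneg_nonneg zero_le_power2)

lemma N_scale: "N (c *\<^sub>R x) = c\<^sup>2 * N x"
  by (simp add: N_def M_linear power2_eq_square)

lemma N_diff: "N (x - y) = N x - 2 * (y \<bullet> M x) + N y"
  using symmetric[of x y] by (simp add: N_def M_linear inner_diff_left inner_diff_right)

lemma N_add: "N (x + y) = N x + 2 * (y \<bullet> M x) + N y"
  using symmetric[of x y] by (simp add: N_def M_linear inner_add_left inner_add_right)

lemma lo_le_hi: "lo \<le> hi"
proof -
  obtain x :: 'a where "norm x = 1" using vector_choose_size[of 1, where 'a = 'a] by auto
  then show ?thesis using lower[of x] upper[of x] by simp
qed

lemma Lipschitz_T: "norm (T x - T y) \<le> sqrt (hi / lo) * norm (x - y)"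
proof -
  have "lo * (norm (T x - T y))\<^sup>2 \<le> hi * (norm (x - y))\<^sup>2"
    using lower[of "T x - T y"] nonexpansive[of x y] upper[of "x - y"] by linarith
  then have "(norm (T x - T y))\<^sup>2 \<le> hi / lo * (norm (x - y))\<^sup>2"
    using lo_pos by (simp add: field_simps)
  then have "norm (T x - T y) \<le> sqrt (hi / lo * (norm (x - y))\<^sup>2)" by (rule real_le_rsqrt)
  then show ?thesis by (simp only: real_sqrt_mult real_sqrt_abs abs_norm_cancel)
qed

lemma Lipschitz_S: "norm (S x - S y) \<le> (1 + sqrt (hi / lo)) * norm (x - y)"
proof -
  have "S x - S y = (x - y) - (T x - T y)" by (simp add: S_def)
  then have "norm (S x - S y) \<le> norm (x - y) + norm (T x - T y)" by (simp add: norm_triangle_ineq4)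
  then show ?thesis using Lipschitz_T[of x y] by (simp add: algebra_simps)
qed

lemma continuous_on_S: "continuous_on X S"
proof (rule continuous_on_subset)
  have "(1 + sqrt (hi / lo))-lipschitz_on UNIV S"
    using lo_pos lo_le_hi by (intro lipschitz_onI) (auto simp: dist_norm Lipschitz_S)
  then show "continuous_on UNIV S" by (rule lipschitz_on_continuous_on)
qed simp

lemma continuous_on_N: "continuous_on X N"
  unfolding N_def by (intro continuous_intros continuous_on_M)

lemma borel_measurable_S [measurable]: "S \<in> borel_measurable borel"
  using continuous_on_S by (rule borel_measurable_continuous_onI)

lemma borel_measurable_N [measurable]: "N \<in> borel_measurable borel"
  using continuous_on_N by (rule borel_measurable_continuous_onI)

text \<open>Because \<open>T w = w\<close>, the vector \<open>(x - w) - S x\<close> is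
  \<open>T x - T w\<close>; its squared norm is expanded.\<close>

lemma cocoercive:
  assumes "T w = w"
  shows "N (S x) \<le> 2 * (S x \<bullet> M (x - w))"
proof -
  have "N ((x - w) - S x) \<le> N (x - w)"
    using nonexpansive[of x w] assms by (simp add: S_def N_def)
  then show ?thesis by (simp add: N_diff[of "x - w"])
qed

lemma N_tendsto_0_iff: "(\<lambda>k. N (f k)) \<longlonglongrightarrow> 0 \<longleftrightarrow> f \<longlonglongrightarrow> 0"
proof
  assume "(\<lambda>k. N (f k)) \<longlonglongrightarrow> 0"
  then have lim: "(\<lambda>k. sqrt (N (f k) / lo)) \<longlonglongrightarrow> 0"
    using lo_pos by (auto intro!: tendsto_eq_intros)
  have "norm (f k) \<le> sqrt (N (f k) / lo)" for k
    using lower[of "f k"] lo_pos by (intro real_le_rsqrt) (simp add: N_def field_simps)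
  then show "f \<longlonglongrightarrow> 0" by (intro Lim_null_comparison[OF _ lim]) simp
next
  assume "f \<longlonglongrightarrow> 0"
  then have "(\<lambda>k. N (f k)) \<longlonglongrightarrow> N 0"
    using continuous_on_N[of UNIV] by (intro isCont_tendsto_compose[of 0 N]) (auto simp: continuous_on_eq_continuous_at)
  then show "(\<lambda>k. N (f k)) \<longlonglongrightarrow> 0" by (simp add: N_def)
qed

text \<open>Young's inequality in the metric of \<open>M\<close>, from the nonnegativity of
  \<open>N (a *\<^sub>R v + c *\<^sub>R u)\<close>.\<close>

lemma cross_term_le:
  assumes "0 < c"
  shows "- 2 * a * (v \<bullet> M u) \<le> a\<^sup>2 / c * N v + c * N u"
proof -
  have "0 \<le> N (a *\<^sub>R v + c *\<^sub>R u)" by (rule N_nonneg)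
  also have "\<dots> = a\<^sup>2 * N v + 2 * (a * (c * (v \<bullet> M u))) + c\<^sup>2 * N u"
    using symmetric[of u v] by (simp add: N_add N_scale M_linear)
  finally have "0 \<le> (a\<^sup>2 * N v + 2 * (a * (c * (v \<bullet> M u))) + c\<^sup>2 * N u) / c"
    using assms by simp
  also have "\<dots> = a\<^sup>2 / c * N v + 2 * a * (v \<bullet> M u) + c * N u"
    using assms by (simp add: field_simps power2_eq_square)
  finally show ?thesis by simp
qed

text \<open>Weighting by \<open>q i\<close> cancels \<open>1 / q i\<close> in the linear term, where
  the blocks then sum to \<open>v\<close>; the quadratic term keeps one factor
  \<open>1 / q i\<close>. The summand with \<open>c * \<tau>\<close> anticipates the weight with
  which the new displacement will enter the Lyapunov function.\<close>

lemma expected_step_le: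
  fixes q :: "nat \<Rightarrow> real"
  assumes fp: "T w = w" and U: "block_resolution n U"
    and q: "\<And>i. i \<in> {1..n} \<Longrightarrow> qmin \<le> q i" "0 < qmin" "(\<Sum>i=1..n. q i) = 1"
    and a: "0 \<le> a" and c: "0 < c"
    and J: "finite J" "card J \<le> \<tau>" and read: "zh = x + (\<Sum>d\<in>J. y d - y (Suc d))"
  defines "v \<equiv> S zh"
  shows "(\<Sum>i=1..n. q i * (N (x - (a / q i) *\<^sub>R U i v - w) + c * \<tau> * N ((a / q i) *\<^sub>R U i v)))
    \<le> N (x - w) + c * (\<Sum>d\<in>J. N (y (Suc d) - y d))
      - a * (1 - a * ((1 + c * \<tau>) * (hi / lo / qmin) + \<tau> / c)) * N v"
proof -
  have qpos: "0 < q i" if "i \<in> {1..n}" for i using q(1)[OF that] q(2) by linarith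
  have U_sum: "(\<Sum>i=1..n. U i v) = v" and U_norm: "(\<Sum>i=1..n. (norm (U i v))\<^sup>2) \<le> (norm v)\<^sup>2"
    using U by (auto simp: block_resolution_def)
  have "(\<Sum>i=1..n. q i * (N (x - (a / q i) *\<^sub>R U i v - w) + c * \<tau> * N ((a / q i) *\<^sub>R U i v)))
      = (\<Sum>i=1..n. q i * N (x - w) - 2 * a * (U i v \<bullet> M (x - w)) + (1 + c * \<tau>) * (a\<^sup>2 * (N (U i v) / q i)))"
  proof (rule sum.cong[OF refl])
    fix i assume "i \<in> {1..n}"
    then have "q i \<noteq> 0" using qpos by force
    moreover have "N (x - (a / q i) *\<^sub>R U i v - w)
        = N (x - w) - 2 * (a / q i) * (U i v \<bullet> M (x - w)) + (a / q i)\<^sup>2 * N (U i v)"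
      using N_diff[of "x - w" "(a / q i) *\<^sub>R U i v"]
      by (simp add: N_scale algebra_simps)
    ultimately show "q i * (N (x - (a / q i) *\<^sub>R U i v - w) + c * \<tau> * N ((a / q i) *\<^sub>R U i v))
        = q i * N (x - w) - 2 * a * (U i v \<bullet> M (x - w)) + (1 + c * \<tau>) * (a\<^sup>2 * (N (U i v) / q i))"
      by (simp only: N_scale) (simp add: field_simps power2_eq_square)
  qed
  also have "\<dots> = (\<Sum>i=1..n. q i) * N (x - w) - 2 * a * ((\<Sum>i=1..n. U i v) \<bullet> M (x - w))
      + (1 + c * \<tau>) * (a\<^sup>2 * (\<Sum>i=1..n. N (U i v) / q i))"
    by (simp only: sum.distrib sum_subtractf sum_distrib_left sum_distrib_right inner_sum_left)
  also have "\<dots> = N (x - w) - 2 * a * (v \<bullet> M (x - w)) + (1 + c * \<tau>) * (a\<^sup>2 * (\<Sum>i=1..n. N (U i v) / q i))"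
    by (simp only: U_sum q(3) mult_1)
  finally have expand: "(\<Sum>i=1..n. q i * (N (x - (a / q i) *\<^sub>R U i v - w) + c * \<tau> * N ((a / q i) *\<^sub>R U i v)))
      = N (x - w) - 2 * a * (v \<bullet> M (x - w)) + (1 + c * \<tau>) * (a\<^sup>2 * (\<Sum>i=1..n. N (U i v) / q i))" .
  \<comment> \<open>The norm condition on the blocks is Euclidean: \<open>upper\<close> leads from
    \<open>N\<close> to the norm and \<open>lower\<close> leads back, at the cost of the factor
    \<open>hi / lo\<close>.\<close>
  have step: "(1 + c * \<tau>) * (a\<^sup>2 * (\<Sum>i=1..n. N (U i v) / q i)) \<le> (1 + c * \<tau>) * (a\<^sup>2 * (hi / lo / qmin * N v))"
  proof (intro mult_left_mono)
    have "(\<Sum>i=1..n. N (U i v) / q i) \<le> (\<Sum>i=1..n. hi * (norm (U i v))\<^sup>2 / qmin)"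
    proof (rule sum_mono)
      fix i assume i: "i \<in> {1..n}"
      have "N (U i v) / q i \<le> N (U i v) / qmin"
        using q(1)[OF i] q(2) N_nonneg by (intro divide_left_mono) (auto intro: qpos[OF i])
      also have "\<dots> \<le> hi * (norm (U i v))\<^sup>2 / qmin"
        using q(2) upper[of "U i v"] by (intro divide_right_mono) (auto simp: N_def)
      finally show "N (U i v) / q i \<le> hi * (norm (U i v))\<^sup>2 / qmin" .
    qed
    also have "\<dots> = hi / qmin * (\<Sum>i=1..n. (norm (U i v))\<^sup>2)"
      by (simp add: sum_distrib_left)
    also have "\<dots> \<le> hi / qmin * (norm v)\<^sup>2"
      using lo_pos lo_le_hi q(2) by (intro mult_left_mono U_norm) auto
    also have "\<dots> \<le> hi / qmin * (N v / lo)"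
      using lower[of v] lo_pos lo_le_hi q(2) by (intro mult_left_mono) (auto simp: N_def field_simps)
    finally show "(\<Sum>i=1..n. N (U i v) / q i) \<le> hi / lo / qmin * N v" by (simp add: field_simps)
  qed (use c in auto)
  have cross: "- 2 * a * (v \<bullet> M (x - w)) \<le> - a * N v + \<tau> * (a\<^sup>2 / c * N v) + c * (\<Sum>d\<in>J. N (y (Suc d) - y d))"
  proof -
    \<comment> \<open>\<open>cocoercive\<close> is applied at \<open>zh\<close>, the point actually
      read. The displacements that separate it from \<open>x\<close>, at most \<tau> in number, are
      split off one by one with \<open>cross_term_le\<close>.\<close>
    have x: "x - w = (zh - w) + (\<Sum>d\<in>J. y (Suc d) - y d)"
      unfolding read by (simp add: sum_subtractf)
    have "- 2 * a * (v \<bullet> M (x - w)) = - a * (2 * (v \<bullet> M (zh - w))) + (\<Sum>d\<in>J. - 2 * a * (v \<bullet> M (y (Suc d) - y d)))"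
    proof -
      have "v \<bullet> M (x - w) = v \<bullet> M (zh - w) + (\<Sum>d\<in>J. v \<bullet> M (y (Suc d) - y d))"
        unfolding x by (simp only: linear_add[OF linear_M] linear_sum[OF linear_M] inner_add_right inner_sum_right)
      then show ?thesis by (simp only:) (simp add: distrib_left sum_distrib_left)
    qed
    also have "- a * (2 * (v \<bullet> M (zh - w))) \<le> - a * N v"
      using mult_left_mono[OF cocoercive[OF fp, of zh] a] by (simp add: v_def)
    also have "(\<Sum>d\<in>J. - 2 * a * (v \<bullet> M (y (Suc d) - y d))) \<le> (\<Sum>d\<in>J. a\<^sup>2 / c * N v + c * N (y (Suc d) - y d))"
      by (intro sum_mono cross_term_le c)
    also have "\<dots> = card J * (a\<^sup>2 / c * N v) + c * (\<Sum>d\<in>J. N (y (Suc d) - y d))"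
      by (simp add: sum.distrib sum_distrib_left)
    also have "card J * (a\<^sup>2 / c * N v) \<le> \<tau> * (a\<^sup>2 / c * N v)"
      using J(2) c N_nonneg by (intro mult_right_mono) auto
    finally show ?thesis by simp
  qed
  have "- a * N v + \<tau> * (a\<^sup>2 / c * N v) + (1 + c * \<tau>) * (a\<^sup>2 * (hi / lo / qmin * N v))
      = - a * (1 - a * ((1 + c * \<tau>) * (hi / lo / qmin) + \<tau> / c)) * N v"
    by (simp add: algebra_simps power2_eq_square add_divide_distrib)
  then show ?thesis using expand step cross by linarith
qed

lemma N_add_le: "N (x + y) \<le> 2 * N x + 2 * N y"
  using N_nonneg[of "x - y"] by (simp add: N_add N_diff)

text \<open>
  Opial's argument: a cluster point \<open>l\<close> is a fixed point, and the convergence of the distances to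
  fixed points arbitrarily close to \<open>l\<close> forces the whole sequence to converge to \<open>l\<close>.
\<close>

lemma Opial:
  assumes D: "D \<noteq> {}" "D \<subseteq> {w. T w = w}" "{w. T w = w} \<subseteq> closure D"
    and conv: "\<And>w. w \<in> D \<Longrightarrow> convergent (\<lambda>k. N (x k - w))"
    and xh: "(\<lambda>k. xh k - x k) \<longlonglongrightarrow> 0" and res: "(\<lambda>k. S (xh k)) \<longlonglongrightarrow> 0"
  obtains l where "T l = l" "x \<longlonglongrightarrow> l"
proof -
  obtain w0 where w0: "w0 \<in> D" using D(1) by blast
  obtain B where B: "\<And>k. \<bar>N (x k - w0)\<bar> \<le> B"
    using conv[OF w0, THEN convergent_imp_Bseq] by (auto simp: Bseq_def)
  have "norm (x k) \<le> norm w0 + sqrt (B / lo)" for k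
  proof -
    have "lo * (norm (x k - w0))\<^sup>2 \<le> B" using lower[of "x k - w0"] B[of k] by (simp add: N_def)
    then have "norm (x k - w0) \<le> sqrt (B / lo)"
      using lo_pos by (intro real_le_rsqrt) (simp add: field_simps)
    then show ?thesis using norm_triangle_ineq[of w0 "x k - w0"] by simp
  qed
  then have "bounded (range x)" by (auto simp: bounded_iff)
  then obtain l r where r: "strict_mono r" and l: "(x \<circ> r) \<longlonglongrightarrow> l"
    using bounded_imp_convergent_subsequence by blast
  have "(\<lambda>k. (xh (r k) - x (r k)) + x (r k)) \<longlonglongrightarrow> 0 + l"
    using LIMSEQ_subseq_LIMSEQ[OF xh r] l by (intro tendsto_add) (simp_all add: o_def)
  then have "(\<lambda>k. S (xh (r k))) \<longlonglongrightarrow> S l"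
    using continuous_on_S[of UNIV]
    by (intro isCont_tendsto_compose[of l S]) (auto simp: continuous_on_eq_continuous_at)
  moreover have "(\<lambda>k. S (xh (r k))) \<longlonglongrightarrow> 0"
    using LIMSEQ_subseq_LIMSEQ[OF res r] by (simp add: o_def)
  ultimately have "S l = 0" by (rule LIMSEQ_unique)
  then have fp: "T l = l" by (simp add: S_def)
  have "(\<lambda>k. N (x k - l)) \<longlonglongrightarrow> 0"
  proof (rule order_tendstoI)
    show "\<forall>\<^sub>F k in sequentially. a < N (x k - l)" if "a < 0" for a
      using that N_nonneg by (auto intro: less_le_trans always_eventually)
  next
    fix e :: real assume "0 < e"
    have "isCont (\<lambda>w. N (w - l)) l"
      using continuous_on_N[of UNIV]
      by (intro isCont_o2[of l "\<lambda>w. w - l" N]) (auto simp: continuous_on_eq_continuous_at)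
    \<comment> \<open>A quarter of \<open>e\<close> each, since \<open>N_add_le\<close> doubles both
      squared distances, from \<open>x k\<close> to \<open>w\<close> and from \<open>w\<close> to
      \<open>l\<close>.\<close>
    then obtain d where "0 < d" and d: "\<And>w. dist w l < d \<Longrightarrow> dist (N (w - l)) (N (l - l)) < e / 4"
    proof -
      have "0 < e / 4" using \<open>0 < e\<close> by simp
      with \<open>isCont (\<lambda>w. N (w - l)) l\<close> show ?thesis
        unfolding continuous_at_eps_delta using that by blast
    qed
    have "l \<in> closure D" using D(3) fp by blast
    then obtain w where w: "w \<in> D" "dist w l < d" using \<open>0 < d\<close> by (auto simp: closure_approachable)
    have w_close: "N (w - l) < e / 4"
      using d[OF w(2)] N_nonneg[of "w - l"] N_scale[of 0 0] by (simp add: dist_real_def)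
    obtain L where L: "(\<lambda>k. N (x k - w)) \<longlonglongrightarrow> L" using conv[OF w(1)] by (auto simp: convergent_def)
    \<comment> \<open>The whole sequence of distances to \<open>w\<close> converges; the subsequence
      only serves to identify its limit.\<close>
    have "(\<lambda>k. N (x (r k) - w)) \<longlonglongrightarrow> N (l - w)"
      using l continuous_on_N[of UNIV]
      by (intro isCont_tendsto_compose[of "l - w" N] tendsto_intros)
        (auto simp: continuous_on_eq_continuous_at o_def)
    then have "L = N (l - w)"
      using LIMSEQ_subseq_LIMSEQ[OF L r] by (auto simp: o_def intro: LIMSEQ_unique)
    also have "\<dots> = N (w - l)" using N_scale[of "-1" "w - l"] by simp
    finally have "\<forall>\<^sub>F k in sequentially. N (x k - w) < e / 4"
      using order_tendstoD(2)[OF L, of "e / 4"] w_close by simp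
    then show "\<forall>\<^sub>F k in sequentially. N (x k - l) < e"
    proof (rule eventually_mono)
      fix k assume "N (x k - w) < e / 4"
      then show "N (x k - l) < e" using N_add_le[of "x k - w" "w - l"] w_close by simp
    qed
  qed
  then have "(\<lambda>k. x k - l) \<longlonglongrightarrow> 0" by (simp add: N_tendsto_0_iff)
  then have "x \<longlonglongrightarrow> l" by (simp add: LIM_zero_iff)
  with fp show thesis by (rule that)
qed

end

lemma window_sum_tendsto_0:
  fixes f :: "nat \<Rightarrow> 'b::real_normed_vector"
  assumes "f \<longlonglongrightarrow> 0"
  shows "(\<lambda>k. \<Sum>d=k - \<tau>..<k. f d) \<longlonglongrightarrow> 0"
\<comment> \<open>From \<tau> on, the truncated subtraction is exact and the window has exactly
  \<tau> terms.\<close>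
proof (rule LIMSEQ_offset[of _ \<tau>])
  have "(\<lambda>k. \<Sum>j<\<tau>. f (k + j)) \<longlonglongrightarrow> (\<Sum>j<\<tau>. 0)"
    by (intro tendsto_sum LIMSEQ_ignore_initial_segment assms)
  moreover have "(\<Sum>j<\<tau>. f (k + j)) = (\<Sum>d=k + \<tau> - \<tau>..<k + \<tau>. f d)" for k
    using sum.shift_bounds_nat_ivl[of f 0 k \<tau>] by (simp add: add.commute atLeast0LessThan)
  ultimately show "(\<lambda>k. \<Sum>d=k + \<tau> - \<tau>..<k + \<tau>. f d) \<longlonglongrightarrow> 0" by simp
qed

lemma bounded_continuous_comp:
  fixes f :: "'w \<Rightarrow> 'a::euclidean_space" and g :: "'a \<Rightarrow> 'b::metric_space"
  assumes "bounded (f ` X)" "continuous_on UNIV g"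
  shows "bounded ((\<lambda>\<omega>. g (f \<omega>)) ` X)"
proof (rule bounded_subset)
  have "compact (closure (f ` X))" using assms(1) by (simp add: compact_closure)
  then show "bounded (g ` closure (f ` X))"
    using continuous_on_subset[OF assms(2)] by (intro compact_imp_bounded compact_continuous_image) auto
  show "(\<lambda>\<omega>. g (f \<omega>)) ` X \<subseteq> g ` closure (f ` X)"
    using closure_subset by fastforce
qed

lemma bounded_sum_comp:
  fixes f :: "'i \<Rightarrow> 'w \<Rightarrow> 'b::real_normed_vector"
  assumes "\<And>i. i \<in> I \<Longrightarrow> bounded (f i ` X)"
  shows "bounded ((\<lambda>\<omega>. \<Sum>i\<in>I. f i \<omega>) ` X)"
  using assms
proof (induction I rule: infinite_finite_induct)
  case (insert i I)
  then show ?case by (simp add: bounded_plus_comp)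
qed (simp_all add: image_constant_conv)

section \<open>Asynchronous randomised block iterations\<close>

text \<open>\<open>U\<close> absorbs the difference between the two algorithms. Reads use windows of
  natural numbers, where truncated subtraction accounts for the start at time zero.\<close>

locale async_iteration =
  nonexpansive_operator M T lo hi + prob_space P
  for M T :: "'a::euclidean_space \<Rightarrow> 'a" and lo hi :: real and P :: "'w measure" +
  fixes n \<tau> :: nat and U :: "nat \<Rightarrow> 'a \<Rightarrow> 'a" and q step :: "nat \<Rightarrow> real"
    and qmin \<eta>min \<eta>max :: real
    and idx :: "nat \<Rightarrow> 'w \<Rightarrow> nat" and z0 :: 'a and z zhat :: "nat \<Rightarrow> 'w \<Rightarrow> 'a"
  assumes fixed_point_exists: "\<exists>w. T w = w"
    and U: "block_resolution n U"
    and q_ge: "i \<in> {1..n} \<Longrightarrow> qmin \<le> q i" and qmin_pos: "0 < qmin" and q_sum: "(\<Sum>i=1..n. q i) = 1"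
    and random: "random_indices P n q idx zhat"
    and z_0: "\<omega> \<in> space P \<Longrightarrow> z 0 \<omega> = z0"
    and read: "\<omega> \<in> space P \<Longrightarrow>
      \<exists>J\<subseteq>{k - \<tau>..<k}. zhat k \<omega> = z k \<omega> + (\<Sum>d\<in>J. z d \<omega> - z (Suc d) \<omega>)"
    and step: "step k \<in> {\<eta>min..\<eta>max}" and eta_min: "0 < \<eta>min"
    and eta_max: "\<eta>max < real n * qmin / (2 * real \<tau> * sqrt (hi / lo * qmin) + hi / lo)"
    and update: "\<omega> \<in> space P \<Longrightarrow> z (Suc k) \<omega> = z k \<omega> -
      (step k / (real n * q (idx k \<omega>))) *\<^sub>R U (idx k \<omega>) (zhat k \<omega> - T (zhat k \<omega>))"
begin

lemma hi_pos: "0 < hi" using lo_pos lo_le_hi by linarith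

lemma n_pos: "0 < n" using q_sum by (cases "n = 0") auto

lemma q_pos: "i \<in> {1..n} \<Longrightarrow> 0 < q i" using q_ge qmin_pos by force

lemma idx_in: "\<omega> \<in> space P \<Longrightarrow> idx k \<omega> \<in> {1..n}"
  using random by (simp add: random_indices_def)

lemma measurable_idx [measurable]: "idx k \<in> measurable P (count_space UNIV)"
  using random by (simp add: random_indices_def)

lemma measurable_zhat [measurable]: "zhat k \<in> borel_measurable P"
  using random by (simp add: random_indices_def)

lemma linear_U: "i \<in> {1..n} \<Longrightarrow> linear (U i)"
  using U by (simp add: block_resolution_def)

lemma continuous_on_U: "i \<in> {1..n} \<Longrightarrow> continuous_on X (U i)"
  by (intro linear_continuous_on linear_U[THEN linear_conv_bounded_linear[THEN iffD1]])

lemma norm_U_le: "i \<in> {1..n} \<Longrightarrow> norm (U i v) \<le> norm v"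
proof (rule power2_le_imp_le)
  assume i: "i \<in> {1..n}"
  have "(norm (U i v))\<^sup>2 \<le> (\<Sum>i=1..n. (norm (U i v))\<^sup>2)"
    by (rule member_le_sum) (use i in auto)
  also have "\<dots> \<le> (norm v)\<^sup>2" using U by (simp add: block_resolution_def)
  finally show "(norm (U i v))\<^sup>2 \<le> (norm v)\<^sup>2" .
qed simp

section \<open>The filtration of indices and reads\<close>

definition F :: "nat \<Rightarrow> 'w measure" where
  "F k = sigma (space P)
     ({idx l -` B \<inter> space P | l B. l < k} \<union> {zhat l -` B \<inter> space P | l B. l \<le> k \<and> B \<in> sets borel})"

lemma space_F [simp]: "space (F k) = space P"
  by (simp add: F_def space_measure_of_conv)

lemma sets_F: "sets (F k) = history P idx zhat k"
  unfolding F_def history_def by (rule sets_measure_of) auto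

lemma sets_F_subset: "sets (F k) \<subseteq> sets P"
  unfolding sets_F history_def
proof (rule sets.sigma_sets_subset, rule Un_least; clarify)
  show "idx l -` B \<inter> space P \<in> events" for l B by (rule measurable_sets[OF measurable_idx]) simp
  show "zhat l -` B \<inter> space P \<in> events" if "B \<in> sets borel" for l B
    by (rule measurable_sets[OF measurable_zhat that])
qed

lemma sets_F_mono: "j \<le> k \<Longrightarrow> sets (F j) \<subseteq> sets (F k)"
  unfolding sets_F history_def
proof (rule sigma_sets_mono', rule Un_mono; rule subsetI)
  assume le: "j \<le> k"
  fix E assume "E \<in> {idx l -` B \<inter> space P | l B. l < j}"
  then obtain l B where "E = idx l -` B \<inter> space P" "l < j" by blast
  moreover from this(2) le have "l < k" by (rule less_le_trans)
  ultimately show "E \<in> {idx l -` B \<inter> space P | l B. l < k}" by blast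
next
  assume le: "j \<le> k"
  fix E assume "E \<in> {zhat l -` B \<inter> space P | l B. l \<le> j \<and> B \<in> sets borel}"
  then obtain l B where "E = zhat l -` B \<inter> space P" "l \<le> j" "B \<in> sets borel" by blast
  moreover from this(2) le have "l \<le> k" by (rule order_trans)
  ultimately show "E \<in> {zhat l -` B \<inter> space P | l B. l \<le> k \<and> B \<in> sets borel}" by blast
qed

lemma subalgebra_F: "subalgebra P (F k)" and subalgebra_F_mono: "j \<le> k \<Longrightarrow> subalgebra (F k) (F j)"
  using sets_F_subset sets_F_mono by (simp_all add: subalgebra_def)

lemma zhat_F [measurable]: "zhat k \<in> borel_measurable (F k)"
proof (rule measurableI)
  fix B :: "'a set" assume "B \<in> sets borel"
  then have "zhat k -` B \<inter> space P \<in> {zhat l -` B \<inter> space P | l B. l \<le> k \<and> B \<in> sets borel}" by blast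
  then show "zhat k -` B \<inter> space (F k) \<in> sets (F k)"
    unfolding sets_F history_def space_F by (intro sigma_sets.Basic UnI2)
qed simp

lemma idx_F: "idx k \<in> measurable (F (Suc k)) (count_space UNIV)"
proof (rule measurableI)
  fix B :: "nat set"
  have "idx k -` B \<inter> space P \<in> {idx l -` B \<inter> space P | l B. l < Suc k}" by blast
  then show "idx k -` B \<inter> space (F (Suc k)) \<in> sets (F (Suc k))"
    unfolding sets_F history_def space_F by (intro sigma_sets.Basic UnI1)
qed simp

text \<open>The index is a parameter rather than \<open>idx k\<close>: for fixed \<open>i\<close>
  the displacement is measurable with respect to the past, which is what independence of the index
  requires.\<close>

definition \<Delta> :: "nat \<Rightarrow> nat \<Rightarrow> 'w \<Rightarrow> 'a" where
  "\<Delta> k i \<omega> = (step k / real n / q i) *\<^sub>R U i (S (zhat k \<omega>))"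

lemma z_Suc: "\<omega> \<in> space P \<Longrightarrow> z (Suc k) \<omega> = z k \<omega> - \<Delta> k (idx k \<omega>) \<omega>"
  using update by (simp add: \<Delta>_def S_def)

lemma \<Delta>_F:
  assumes "i \<in> {1..n}"
  shows "\<Delta> k i \<in> borel_measurable (F k)"
proof -
  have [measurable]: "U i \<in> borel_measurable borel"
    using continuous_on_U[OF assms] by (rule borel_measurable_continuous_onI)
  show ?thesis unfolding \<Delta>_def by measurable
qed

text \<open>Measurability of the iterates is inherited through the update rule; the selection of a
  block by the random index is written as a finite sum of indicators.\<close>

lemma z_F: "z k \<in> borel_measurable (F k)"
proof (induction k)
  case 0
  have "z 0 \<in> borel_measurable (F 0) \<longleftrightarrow> (\<lambda>_. z0) \<in> borel_measurable (F 0)"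
    by (rule measurable_cong) (simp add: z_0)
  then show ?case by simp
next
  case (Suc k)
  have sub: "f \<in> borel_measurable (F (Suc k))" if "f \<in> borel_measurable (F k)" for f :: "'w \<Rightarrow> 'a"
    by (rule measurable_from_subalg[OF subalgebra_F_mono that]) simp
  have "z (Suc k) \<in> borel_measurable (F (Suc k)) \<longleftrightarrow>
      (\<lambda>\<omega>. z k \<omega> - (\<Sum>i=1..n. indicator {i} (idx k \<omega>) *\<^sub>R \<Delta> k i \<omega>)) \<in> borel_measurable (F (Suc k))"
  proof (rule measurable_cong)
    fix \<omega> assume "\<omega> \<in> space (F (Suc k))"
    then have \<omega>: "\<omega> \<in> space P" by simp
    have "(\<Sum>i=1..n. indicator {i} (idx k \<omega>) *\<^sub>R \<Delta> k i \<omega>) = (\<Sum>i=1..n. if i = idx k \<omega> then \<Delta> k i \<omega> else 0)"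
      by (rule sum.cong) auto
    also have "\<dots> = \<Delta> k (idx k \<omega>) \<omega>" using idx_in[OF \<omega>] by (simp add: sum.delta)
    finally show "z (Suc k) \<omega> = z k \<omega> - (\<Sum>i=1..n. indicator {i} (idx k \<omega>) *\<^sub>R \<Delta> k i \<omega>)"
      using z_Suc[OF \<omega>] by simp
  qed
  also have "\<dots>"
  proof (intro borel_measurable_diff sub[OF Suc] borel_measurable_sum borel_measurable_scaleR)
    show "(\<lambda>\<omega>. indicator {i} (idx k \<omega>) :: real) \<in> borel_measurable (F (Suc k))" for i
      by (rule measurable_compose[OF idx_F]) simp
    show "\<Delta> k i \<in> borel_measurable (F (Suc k))" if "i \<in> {1..n}" for i
      using that by (intro sub \<Delta>_F)
  qed
  finally show ?case .
qed

lemma z_F': "l \<le> k \<Longrightarrow> z l \<in> borel_measurable (F k)"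
  by (rule measurable_from_subalg[OF subalgebra_F_mono z_F])

lemma measurable_z [measurable]: "z k \<in> borel_measurable P"
  by (rule measurable_from_subalg[OF subalgebra_F z_F])

text \<open>Since the initial point and the steps are deterministic, every iterate is bounded.\<close>

lemma bounded_zhat_if:
  assumes "\<And>l. l \<le> k \<Longrightarrow> bounded (z l ` space P)"
  shows "bounded (zhat k ` space P)"
proof (rule bounded_subset)
  \<comment> \<open>The set \<open>J\<close> may depend on the outcome, but only finitely many sets
    are possible, so the read stays in a finite union of bounded sets.\<close>
  let ?f = "\<lambda>J \<omega>. z k \<omega> + (\<Sum>d\<in>J. z d \<omega> - z (Suc d) \<omega>)"
  show "bounded (\<Union>J\<in>Pow {k - \<tau>..<k}. ?f J ` space P)"
  proof (rule bounded_UN)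
    show "\<forall>J\<in>Pow {k - \<tau>..<k}. bounded (?f J ` space P)"
      by (auto intro!: bounded_plus_comp bounded_minus_comp bounded_sum_comp assms)
  qed simp
  show "zhat k ` space P \<subseteq> (\<Union>J\<in>Pow {k - \<tau>..<k}. ?f J ` space P)"
  proof
    fix y assume "y \<in> zhat k ` space P"
    then obtain \<omega> where \<omega>: "\<omega> \<in> space P" "y = zhat k \<omega>" by blast
    obtain J where "J \<subseteq> {k - \<tau>..<k}" "zhat k \<omega> = ?f J \<omega>" using read[OF \<omega>(1)] by blast
    then show "y \<in> (\<Union>J\<in>Pow {k - \<tau>..<k}. ?f J ` space P)" using \<omega> by blast
  qed
qed

lemma bounded_\<Delta>_if:
  assumes "bounded (zhat k ` space P)" "i \<in> {1..n}"
  shows "bounded (\<Delta> k i ` space P)"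
  unfolding \<Delta>_def
  by (intro bounded_scaleR_comp bounded_continuous_comp[OF _ continuous_on_U]
      bounded_continuous_comp[OF _ continuous_on_S] assms)

lemma bounded_z_le: "l \<le> k \<Longrightarrow> bounded (z l ` space P)"
proof (induction k arbitrary: l)
  case 0
  have "z 0 ` space P \<subseteq> {z0}" using z_0 by auto
  then show ?case using 0 by (simp add: bounded_subset[of "{z0}"])
next
  case (Suc k)
  have "bounded (z (Suc k) ` space P)"
  proof (rule bounded_subset)
    show "bounded (\<Union>i\<in>{1..n}. (\<lambda>\<omega>. z k \<omega> - \<Delta> k i \<omega>) ` space P)"
      using Suc.IH by (auto intro!: bounded_UN bounded_minus_comp bounded_\<Delta>_if bounded_zhat_if)
    show "z (Suc k) ` space P \<subseteq> (\<Union>i\<in>{1..n}. (\<lambda>\<omega>. z k \<omega> - \<Delta> k i \<omega>) ` space P)"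
      using z_Suc idx_in by blast
  qed
  then show ?case using Suc by (cases "l = Suc k") auto
qed

lemma bounded_z: "bounded (z k ` space P)" using bounded_z_le[of k k] by simp
lemma bounded_zhat: "bounded (zhat k ` space P)" by (intro bounded_zhat_if bounded_z)
lemma bounded_\<Delta>: "i \<in> {1..n} \<Longrightarrow> bounded (\<Delta> k i ` space P)" by (intro bounded_\<Delta>_if bounded_zhat)

section \<open>Averaging over a fresh index\<close>

lemma integrable_if_bounded:
  fixes f :: "'w \<Rightarrow> real"
  assumes "f \<in> borel_measurable P" "bounded (f ` space P)"
  shows "integrable P f"
proof -
  obtain B where "\<And>\<omega>. \<omega> \<in> space P \<Longrightarrow> \<bar>f \<omega>\<bar> \<le> B" using assms(2) by (auto simp: bounded_iff)
  then show ?thesis using assms(1) by (rule integrable_bounded[rotated])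
qed

lemma measurable_indicator_idx: "(\<lambda>\<omega>. indicator {i} (idx k \<omega>) :: real) \<in> borel_measurable P"
  by (rule measurable_compose[OF measurable_idx]) simp

lemma expectation_indicator_idx:
  fixes f :: "'w \<Rightarrow> real"
  assumes f: "f \<in> borel_measurable (F k)" "bounded (f ` space P)" and i: "i \<in> {1..n}"
  shows "(\<integral>\<omega>. f \<omega> * indicator {i} (idx k \<omega>) \<partial>P) = q i * expectation f"
proof -
  have f_P: "f \<in> borel_measurable P" using f(1) by (rule measurable_from_subalg[OF subalgebra_F])
  let ?g = "\<lambda>\<omega>. indicator {i} (idx k \<omega>) :: real"
  have g_P: "?g \<in> borel_measurable P" by (rule measurable_indicator_idx)
  have indep: "indep_set (history P idx zhat k) {idx k -` B \<inter> space P | B. True}"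
    using random by (simp add: random_indices_def)
  have "indep_var borel f borel ?g"
    unfolding indep_var_eq
  proof (intro conjI indep_set_sigma_sets f_P g_P)
    show "indep_set {f -` A \<inter> space P |A. A \<in> sets borel} {?g -` A \<inter> space P |A. A \<in> sets borel}"
    proof (rule indep_setI)
      show "{f -` A \<inter> space P |A. A \<in> sets borel} \<subseteq> events" "{?g -` A \<inter> space P |A. A \<in> sets borel} \<subseteq> events"
        using measurable_sets[OF f_P] measurable_sets[OF g_P] by blast+
      fix a b
      assume "a \<in> {f -` A \<inter> space P |A. A \<in> sets borel}" "b \<in> {?g -` A \<inter> space P |A. A \<in> sets borel}"
      then obtain A B where A: "A \<in> sets borel" "a = f -` A \<inter> space P" and B: "b = ?g -` B \<inter> space P" by blast
      have "a \<in> history P idx zhat k"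
        using measurable_sets[OF f(1) A(1)] A(2) by (simp add: sets_F)
      moreover have "b = idx k -` (indicator {i} -` B) \<inter> space P" unfolding B by auto
      then have "b \<in> {idx k -` B \<inter> space P | B. True}" by blast
      ultimately show "prob (a \<inter> b) = prob a * prob b" by (rule indep_setD[OF indep])
    qed
    \<comment> \<open>Independence of random variables concerns generated sigma-algebras; it extends
      from the preimages to these because preimages are closed under intersection.\<close>
    have pre: "Int_stable {h -` A \<inter> space P |A. A \<in> sets borel}" for h :: "'w \<Rightarrow> real"
    proof (rule Int_stableI)
      fix a b assume "a \<in> {h -` A \<inter> space P |A. A \<in> sets borel}" "b \<in> {h -` A \<inter> space P |A. A \<in> sets borel}"
      then obtain A B where AB: "A \<in> sets borel" "a = h -` A \<inter> space P" "B \<in> sets borel" "b = h -` B \<inter> space P"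
        by blast
      then have "a \<inter> b = h -` (A \<inter> B) \<inter> space P" "A \<inter> B \<in> sets borel" by auto
      then show "a \<inter> b \<in> {h -` A \<inter> space P |A. A \<in> sets borel}" by blast
    qed
    show "Int_stable {f -` A \<inter> space P |A. A \<in> sets borel}" "Int_stable {?g -` A \<inter> space P |A. A \<in> sets borel}"
      by (rule pre)+
  qed
  moreover have "integrable P f" using f_P f(2) by (rule integrable_if_bounded)
  moreover have "integrable P ?g" using g_P by (rule integrable_bounded[of _ 1]) auto
  ultimately have "(\<integral>\<omega>. f \<omega> * ?g \<omega> \<partial>P) = expectation f * expectation ?g"
    by (rule indep_var_lebesgue_integral)
  also have "expectation ?g = (\<integral>\<omega>. indicator {\<omega> \<in> space P. idx k \<omega> = i} \<omega> \<partial>P)"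
    by (rule Bochner_Integration.integral_cong) (auto simp: indicator_def)
  also have "\<dots> = prob {\<omega> \<in> space P. idx k \<omega> = i}" by simp
  also have "\<dots> = q i" using random i by (simp add: random_indices_def)
  finally show ?thesis by simp
qed

text \<open>The substitute for conditioning on \<open>F k\<close>: the functions \<open>f i\<close>
  of the past are frozen for each value of the index and, by independence, recombined with the
  weights \<open>q i\<close>.\<close>

lemma expectation_at_idx:
  fixes f :: "nat \<Rightarrow> 'w \<Rightarrow> real"
  assumes f: "\<And>i. i \<in> {1..n} \<Longrightarrow> f i \<in> borel_measurable (F k)"
    and bd: "\<And>i. i \<in> {1..n} \<Longrightarrow> bounded (f i ` space P)"
  shows "(\<integral>\<omega>. f (idx k \<omega>) \<omega> \<partial>P) = (\<integral>\<omega>. (\<Sum>i=1..n. q i * f i \<omega>) \<partial>P)"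
proof -
  have f_P: "f i \<in> borel_measurable P" if "i \<in> {1..n}" for i
    using f[OF that] by (rule measurable_from_subalg[OF subalgebra_F])
  have int: "integrable P (f i)" if "i \<in> {1..n}" for i
    using f_P[OF that] bd[OF that] by (rule integrable_if_bounded)
  have "(\<integral>\<omega>. f (idx k \<omega>) \<omega> \<partial>P) = (\<integral>\<omega>. (\<Sum>i=1..n. f i \<omega> * indicator {i} (idx k \<omega>)) \<partial>P)"
  proof (rule Bochner_Integration.integral_cong[OF refl])
    fix \<omega> assume \<omega>: "\<omega> \<in> space P"
    have "(\<Sum>i=1..n. f i \<omega> * indicator {i} (idx k \<omega>)) = (\<Sum>i=1..n. if i = idx k \<omega> then f i \<omega> else 0)"
      by (rule sum.cong) auto
    also have "\<dots> = f (idx k \<omega>) \<omega>" using idx_in[OF \<omega>] by (simp add: sum.delta)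
    finally show "f (idx k \<omega>) \<omega> = (\<Sum>i=1..n. f i \<omega> * indicator {i} (idx k \<omega>))" by simp
  qed
  also have "\<dots> = (\<Sum>i=1..n. \<integral>\<omega>. f i \<omega> * indicator {i} (idx k \<omega>) \<partial>P)"
  proof (rule Bochner_Integration.integral_sum)
    fix i assume i: "i \<in> {1..n}"
    obtain B where B: "\<And>\<omega>. \<omega> \<in> space P \<Longrightarrow> \<bar>f i \<omega>\<bar> \<le> B" using bd[OF i] by (auto simp: bounded_iff)
    show "integrable P (\<lambda>\<omega>. f i \<omega> * indicator {i} (idx k \<omega>))"
    proof (rule integrable_bounded)
      show "\<bar>f i \<omega> * indicator {i} (idx k \<omega>)\<bar> \<le> B" if "\<omega> \<in> space P" for \<omega>
        using B[OF that] by (auto simp: indicator_def)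
    qed (intro borel_measurable_times measurable_indicator_idx f_P[OF i])
  qed
  also have "\<dots> = (\<Sum>i=1..n. q i * expectation (f i))"
    by (intro sum.cong refl expectation_indicator_idx f bd)
  also have "\<dots> = (\<integral>\<omega>. (\<Sum>i=1..n. q i * f i \<omega>) \<partial>P)"
    by (subst Bochner_Integration.integral_sum) (auto intro: int simp del: One_nat_def)
  finally show ?thesis .
qed

section \<open>Step size constants and the Lyapunov function\<close>

definition C :: real where "C = hi / lo / qmin"

text \<open>The choice \<open>c = 1 / sqrt C\<close> minimises \<open>(1 + c * \<tau>) * C + \<tau> / c\<close>; this is where the step size bound comes from.\<close>

definition c :: real where "c = 1 / sqrt C"

text \<open>A lower bound, uniform in \<open>k\<close>, for the coefficient of the residual in
  \<open>expected_step_le\<close>: the outer step size is replaced by its minimum, the one in the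
  bracket by its maximum.\<close>

definition rate :: real where
  "rate = \<eta>min / n * (1 - \<eta>max / n * (C + 2 * \<tau> * sqrt C))"

lemma C_pos: "0 < C" using hi_pos lo_pos qmin_pos by (simp add: C_def)

lemma c_pos: "0 < c" using C_pos by (simp add: c_def)

text \<open>\<open>c * C\<close> and \<open>1 / c\<close> both equal \<open>sqrt C\<close>, so the
  two costs of delay coincide.\<close>

lemma c_balances: "(1 + c * \<tau>) * C + \<tau> / c = C + 2 * \<tau> * sqrt C"
proof -
  have "c * C = sqrt C" "1 / c = sqrt C"
    using C_pos by (simp_all add: c_def real_div_sqrt)
  then show ?thesis by (simp add: algebra_simps divide_inverse)
qed

text \<open>Writing \<open>hi / lo\<close> as \<open>qmin * C\<close> gives
  \<open>sqrt (hi / lo * qmin) = qmin * sqrt C\<close>; then \<open>qmin\<close> cancels and the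
  step size hypothesis reads \<open>\<eta>max < n / (C + 2 * \<tau> * sqrt C)\<close>.\<close>

lemma rate_factor_pos: "0 < 1 - \<eta>max / n * (C + 2 * \<tau> * sqrt C)"
proof -
  have "sqrt (hi / lo * qmin) = qmin * sqrt C"
  proof -
    have "hi / lo * qmin = qmin\<^sup>2 * C" using qmin_pos by (simp add: C_def power2_eq_square)
    then show ?thesis using qmin_pos by (simp add: real_sqrt_mult)
  qed
  moreover have "hi / lo = qmin * C" using qmin_pos by (simp add: C_def)
  ultimately have "2 * real \<tau> * sqrt (hi / lo * qmin) + hi / lo = qmin * (C + 2 * \<tau> * sqrt C)"
    by (simp add: algebra_simps)
  then have "\<eta>max < n / (C + 2 * \<tau> * sqrt C)" using eta_max qmin_pos by simp
  moreover have "0 < C + 2 * \<tau> * sqrt C" using C_pos by (simp add: add_pos_nonneg)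
  ultimately have "\<eta>max * (C + 2 * \<tau> * sqrt C) < n" by (simp add: pos_less_divide_eq)
  then show ?thesis using n_pos by (simp add: field_simps)
qed

lemma rate_pos: "0 < rate"
  unfolding rate_def using eta_min n_pos by (intro mult_pos_pos rate_factor_pos) auto

lemma rate_le:
  assumes "0 \<le> v"
  shows "rate * v \<le> step k / n * (1 - step k / n * ((1 + c * \<tau>) * (hi / lo / qmin) + \<tau> / c)) * v"
  unfolding C_def[symmetric] c_balances rate_def
proof (intro mult_right_mono mult_mono assms)
  have K: "0 < C + 2 * \<tau> * sqrt C" using C_pos by (simp add: add_pos_nonneg)
  show "\<eta>min / n \<le> step k / n" using step[of k] by (simp add: divide_right_mono)
  show "0 \<le> step k / n" using step[of k] eta_min by simp
  show "1 - \<eta>max / n * (C + 2 * \<tau> * sqrt C) \<le> 1 - step k / n * (C + 2 * \<tau> * sqrt C)"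
    using step[of k] K by (intro diff_left_mono mult_right_mono divide_right_mono) auto
  show "0 \<le> 1 - \<eta>max / n * (C + 2 * \<tau> * sqrt C)"
    using rate_factor_pos by (rule less_imp_le)
qed

text \<open>The truncated weight \<open>d + \<tau> + 1 - k\<close> vanishes for displacements older than the maximal delay.\<close>

definition lyapunov :: "'a \<Rightarrow> nat \<Rightarrow> 'w \<Rightarrow> real" where
  "lyapunov w k \<omega> = N (z k \<omega> - w)
    + c * (\<Sum>d<k. real (d + Suc \<tau> - k) * N (z (Suc d) \<omega> - z d \<omega>))"

text \<open>What \<open>lyapunov\<close> becomes at time \<open>Suc k\<close> if index
  \<open>i\<close> is drawn, again with \<open>i\<close> frozen. All old weights have moved down by
  one step, and the newest displacement enters with weight \<tau>.\<close>

definition lyapunov_next :: "'a \<Rightarrow> nat \<Rightarrow> nat \<Rightarrow> 'w \<Rightarrow> real" where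
  "lyapunov_next w k i \<omega> = N (z k \<omega> - \<Delta> k i \<omega> - w) + c * \<tau> * N (\<Delta> k i \<omega>)
    + c * (\<Sum>d<k. real (d + \<tau> - k) * N (z (Suc d) \<omega> - z d \<omega>))"

lemma lyapunov_Suc:
  assumes "\<omega> \<in> space P"
  shows "lyapunov w (Suc k) \<omega> = lyapunov_next w k (idx k \<omega>) \<omega>"
proof -
  have "z (Suc k) \<omega> - z k \<omega> = (-1) *\<^sub>R \<Delta> k (idx k \<omega>) \<omega>" using z_Suc[OF assms] by simp
  then have "N (z (Suc k) \<omega> - z k \<omega>) = N (\<Delta> k (idx k \<omega>) \<omega>)" by (simp only: N_scale) simp
  then show ?thesis
    unfolding lyapunov_def lyapunov_next_def sum.lessThan_Suc
    by (simp only: z_Suc[OF assms, symmetric] add_Suc_right diff_Suc_Suc diff_add_inverse) (simp add: distrib_left)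
qed

lemma lyapunov_nonneg: "0 \<le> lyapunov w k \<omega>"
  unfolding lyapunov_def using c_pos N_nonneg
  by (intro add_nonneg_nonneg mult_nonneg_nonneg sum_nonneg) auto

lemma lyapunov_descent:
  assumes fp: "T w = w" and \<omega>: "\<omega> \<in> space P"
  shows "(\<Sum>i=1..n. q i * lyapunov_next w k i \<omega>) \<le> lyapunov w k \<omega> - rate * N (S (zhat k \<omega>))"
proof -
  define D where "D d = N (z (Suc d) \<omega> - z d \<omega>)" for d
  define R where "R = c * (\<Sum>d<k. real (d + \<tau> - k) * D d)"
  define v where "v = N (S (zhat k \<omega>))"
  have D_nonneg: "0 \<le> D d" for d by (simp add: D_def N_nonneg)
  obtain J where J: "J \<subseteq> {k - \<tau>..<k}" and rd: "zhat k \<omega> = z k \<omega> + (\<Sum>d\<in>J. z d \<omega> - z (Suc d) \<omega>)"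
    using read[OF \<omega>] by blast
  have "card J \<le> card {k - \<tau>..<k}" using J by (intro card_mono) auto
  then have card_J: "card J \<le> \<tau>" by simp
  have fin: "finite J" by (rule finite_subset[OF J]) simp
  have "(\<Sum>i=1..n. q i * lyapunov_next w k i \<omega>)
      = (\<Sum>i=1..n. q i * (N (z k \<omega> - \<Delta> k i \<omega> - w) + c * \<tau> * N (\<Delta> k i \<omega>)) + q i * R)"
    unfolding lyapunov_next_def R_def D_def by (intro sum.cong refl distrib_left)
  also have "\<dots> = (\<Sum>i=1..n. q i * (N (z k \<omega> - \<Delta> k i \<omega> - w) + c * \<tau> * N (\<Delta> k i \<omega>))) + R"
    by (simp only: sum.distrib sum_distrib_right[symmetric] q_sum mult_1)
  finally have split: "(\<Sum>i=1..n. q i * lyapunov_next w k i \<omega>) =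
      (\<Sum>i=1..n. q i * (N (z k \<omega> - \<Delta> k i \<omega> - w) + c * \<tau> * N (\<Delta> k i \<omega>))) + R" .
  have "0 \<le> step k / n" using step[of k] eta_min by simp
  from expected_step_le[where y = "\<lambda>d. z d \<omega>" and a = "step k / n",
      OF fp U q_ge qmin_pos q_sum this c_pos fin card_J rd]
  have "(\<Sum>i=1..n. q i * (N (z k \<omega> - \<Delta> k i \<omega> - w) + c * \<tau> * N (\<Delta> k i \<omega>)))
      \<le> N (z k \<omega> - w) + c * (\<Sum>d\<in>J. D d)
        - step k / n * (1 - step k / n * ((1 + c * \<tau>) * (hi / lo / qmin) + \<tau> / c)) * v"
    unfolding \<Delta>_def D_def v_def .
  moreover have "rate * v \<le> step k / n * (1 - step k / n * ((1 + c * \<tau>) * (hi / lo / qmin) + \<tau> / c)) * v"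
    unfolding v_def by (intro rate_le N_nonneg)
  \<comment> \<open>The passage to \<open>Suc k\<close> lowers the weight of every displacement with
    \<open>k \<le> d + \<tau>\<close> by exactly one. This releases \<open>c * D d\<close> for each
    \<open>d\<close> in the window, enough to pay for those in \<open>J\<close>.\<close>
  moreover have "c * (\<Sum>d\<in>J. D d) + R \<le> c * (\<Sum>d<k. real (d + Suc \<tau> - k) * D d)"
  proof -
    have "{..<k} \<inter> J = J" using J by auto
    then have "(\<Sum>d\<in>J. D d) = (\<Sum>d<k. if d \<in> J then D d else 0)"
      by (metis finite_lessThan sum.inter_restrict)
    then have "(\<Sum>d\<in>J. D d) + (\<Sum>d<k. real (d + \<tau> - k) * D d)
        = (\<Sum>d<k. (if d \<in> J then D d else 0) + real (d + \<tau> - k) * D d)"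
      by (simp only: sum.distrib)
    also have "\<dots> \<le> (\<Sum>d<k. real (d + Suc \<tau> - k) * D d)"
    proof (rule sum_mono)
      fix d
      have "(if d \<in> J then 1 else 0) + real (d + \<tau> - k) \<le> real (d + Suc \<tau> - k)"
      proof (cases "d \<in> J")
        case True
        then have "k \<le> d + \<tau>" using J by fastforce
        then show ?thesis using True by (simp add: Suc_diff_le)
      qed (simp add: diff_le_mono)
      from mult_right_mono[OF this D_nonneg[of d]]
      show "(if d \<in> J then D d else 0) + real (d + \<tau> - k) * D d \<le> real (d + Suc \<tau> - k) * D d"
        by (cases "d \<in> J") (simp_all add: distrib_right)
    qed
    finally show ?thesis
      unfolding R_def distrib_left[symmetric] using c_pos by (intro mult_left_mono) auto
  qed
  ultimately show ?thesis unfolding split lyapunov_def v_def D_def by linarith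
qed

lemma bounded_N_comp: "bounded (f ` space P) \<Longrightarrow> bounded ((\<lambda>\<omega>. N (f \<omega>)) ` space P)"
  by (rule bounded_continuous_comp[OF _ continuous_on_N])

lemma bounded_mult_left_comp:
  fixes f :: "'w \<Rightarrow> real"
  shows "bounded (f ` X) \<Longrightarrow> bounded ((\<lambda>\<omega>. a * f \<omega>) ` X)"
  using bounded_scaleR_comp[of f X a] by simp

lemma bounded_const_comp: "bounded ((\<lambda>_. a) ` X)"
  by (rule bounded_subset[of "{a}"]) auto

lemma bounded_lyapunov: "bounded (lyapunov w k ` space P)"
  unfolding lyapunov_def
  by (intro bounded_plus_comp bounded_N_comp bounded_mult_left_comp bounded_sum_comp bounded_minus_comp
      bounded_z bounded_const_comp)

lemma bounded_lyapunov_next: "i \<in> {1..n} \<Longrightarrow> bounded (lyapunov_next w k i ` space P)"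
  unfolding lyapunov_next_def
  by (intro bounded_plus_comp bounded_N_comp bounded_mult_left_comp bounded_sum_comp bounded_minus_comp
      bounded_z bounded_\<Delta> bounded_const_comp)

lemma N_F: "f \<in> borel_measurable (F k) \<Longrightarrow> (\<lambda>\<omega>. N (f \<omega>)) \<in> borel_measurable (F k)"
  by (rule measurable_compose[OF _ borel_measurable_N])

lemma lyapunov_F: "lyapunov w k \<in> borel_measurable (F k)"
  unfolding lyapunov_def
  by (intro borel_measurable_add borel_measurable_times borel_measurable_sum N_F borel_measurable_diff
      borel_measurable_const z_F') auto

lemma lyapunov_next_F: "i \<in> {1..n} \<Longrightarrow> lyapunov_next w k i \<in> borel_measurable (F k)"
  unfolding lyapunov_next_def
  by (intro borel_measurable_add borel_measurable_times borel_measurable_sum N_F borel_measurable_diff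
      borel_measurable_const z_F' \<Delta>_F) auto

lemma integrable_lyapunov: "integrable P (lyapunov w k)"
  by (intro integrable_if_bounded bounded_lyapunov measurable_from_subalg[OF subalgebra_F lyapunov_F])

lemma residual_F: "(\<lambda>\<omega>. rate * N (S (zhat k \<omega>))) \<in> borel_measurable (F k)"
  by (intro borel_measurable_times borel_measurable_const N_F measurable_compose[OF zhat_F borel_measurable_S])

lemma bounded_residual: "bounded ((\<lambda>\<omega>. rate * N (S (zhat k \<omega>))) ` space P)"
  by (intro bounded_mult_left_comp bounded_N_comp bounded_continuous_comp[OF bounded_zhat continuous_on_S])

lemma integrable_residual: "integrable P (\<lambda>\<omega>. rate * N (S (zhat k \<omega>)))"
  by (intro integrable_if_bounded bounded_residual measurable_from_subalg[OF subalgebra_F residual_F])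

lemma integrable_indicator_mult:
  fixes f :: "'w \<Rightarrow> real"
  shows "B \<in> events \<Longrightarrow> integrable P f \<Longrightarrow> integrable P (\<lambda>\<omega>. indicator B \<omega> * f \<omega>)"
  using integrable_real_mult_indicator[of B P f] by (simp add: mult.commute)

lemma nonneg_supermartingale_lyapunov:
  assumes fp: "T w = w"
  shows "nonneg_supermartingale P F (lyapunov w) (\<lambda>k \<omega>. rate * N (S (zhat k \<omega>)))"
proof (intro nonneg_supermartingale.intro nonneg_supermartingale_axioms.intro)
  show "prob_space P" by (rule prob_space_axioms)
  show "space (F k) = space P" "sets (F k) \<subseteq> events" "sets (F k) \<subseteq> sets (F (Suc k))" for k
    by (simp_all add: sets_F_subset sets_F_mono)
  show "lyapunov w k \<in> borel_measurable (F k)" for k by (rule lyapunov_F)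
  show "integrable P (lyapunov w k)" "integrable P (\<lambda>\<omega>. rate * N (S (zhat k \<omega>)))" for k
    by (rule integrable_lyapunov integrable_residual)+
  show "0 \<le> lyapunov w k \<omega>" for k \<omega> by (rule lyapunov_nonneg)
  show "0 \<le> rate * N (S (zhat k \<omega>))" for k \<omega>
    using rate_pos N_nonneg by (intro mult_nonneg_nonneg) auto
  fix B k assume B: "B \<in> sets (F k)"
  then have B': "B \<in> events" using sets_F_subset by blast
  let ?f = "\<lambda>i \<omega>. indicator B \<omega> * lyapunov_next w k i \<omega>"
  have int: "integrable P (?f i)" if "i \<in> {1..n}" for i
    using that by (intro integrable_indicator_mult B' integrable_if_bounded bounded_lyapunov_next
        measurable_from_subalg[OF subalgebra_F lyapunov_next_F])
  have "(\<integral>\<omega>. indicator B \<omega> * lyapunov w (Suc k) \<omega> \<partial>P) = (\<integral>\<omega>. ?f (idx k \<omega>) \<omega> \<partial>P)"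
    by (rule Bochner_Integration.integral_cong) (simp_all add: lyapunov_Suc)
  also have "\<dots> = (\<integral>\<omega>. (\<Sum>i=1..n. q i * ?f i \<omega>) \<partial>P)"
  proof (rule expectation_at_idx)
    fix i assume i: "i \<in> {1..n}"
    show "?f i \<in> borel_measurable (F k)"
      by (intro borel_measurable_times borel_measurable_indicator B lyapunov_next_F i)
    obtain b where b: "\<And>\<omega>. \<omega> \<in> space P \<Longrightarrow> \<bar>lyapunov_next w k i \<omega>\<bar> \<le> b"
      using bounded_lyapunov_next[OF i, of w k] by (auto simp: bounded_iff)
    have "\<bar>?f i \<omega>\<bar> \<le> b" if "\<omega> \<in> space P" for \<omega>
      using b[OF that] by (auto simp: indicator_def)
    then show "bounded (?f i ` space P)" by (auto simp: bounded_iff)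
  qed
  also have "\<dots> \<le> (\<integral>\<omega>. indicator B \<omega> * (lyapunov w k \<omega> - rate * N (S (zhat k \<omega>))) \<partial>P)"
  proof (rule integral_mono)
    show "integrable P (\<lambda>\<omega>. \<Sum>i=1..n. q i * ?f i \<omega>)"
      by (intro Bochner_Integration.integrable_sum Bochner_Integration.integrable_mult_right int)
    show "integrable P (\<lambda>\<omega>. indicator B \<omega> * (lyapunov w k \<omega> - rate * N (S (zhat k \<omega>))))"
      by (intro integrable_indicator_mult B' Bochner_Integration.integrable_diff integrable_lyapunov integrable_residual)
    fix \<omega> assume "\<omega> \<in> space P"
    have "(\<Sum>i=1..n. q i * ?f i \<omega>) = indicator B \<omega> * (\<Sum>i=1..n. q i * lyapunov_next w k i \<omega>)"
      unfolding sum_distrib_left by (intro sum.cong refl) (rule mult.left_commute)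
    also have "\<dots> \<le> indicator B \<omega> * (lyapunov w k \<omega> - rate * N (S (zhat k \<omega>)))"
      by (intro mult_left_mono lyapunov_descent fp) (simp_all add: \<open>\<omega> \<in> space P\<close>)
    finally show "(\<Sum>i=1..n. q i * ?f i \<omega>) \<le> indicator B \<omega> * (lyapunov w k \<omega> - rate * N (S (zhat k \<omega>)))" .
  qed
  finally show "(\<integral>\<omega>. indicator B \<omega> * lyapunov w (Suc k) \<omega> \<partial>P)
      \<le> (\<integral>\<omega>. indicator B \<omega> * (lyapunov w k \<omega> - rate * N (S (zhat k \<omega>))) \<partial>P)" .
qed

section \<open>Almost sure limits\<close>

lemma displacement_le:
  assumes "\<omega> \<in> space P"
  shows "norm (z (Suc k) \<omega> - z k \<omega>) \<le> \<eta>max / n / qmin * norm (S (zhat k \<omega>))"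
proof -
  let ?i = "idx k \<omega>"
  have i: "?i \<in> {1..n}" using assms by (rule idx_in)
  have "step k / n / q ?i \<le> \<eta>max / n / qmin"
    using step[of k] eta_min q_ge[OF i] qmin_pos by (intro frac_le divide_right_mono) auto
  moreover have "0 \<le> step k / n / q ?i" using step[of k] eta_min q_pos[OF i] by simp
  ultimately have "step k / n / q ?i * norm (U ?i (S (zhat k \<omega>))) \<le> \<eta>max / n / qmin * norm (S (zhat k \<omega>))"
    using norm_U_le[OF i] by (intro mult_mono) auto
  moreover have "norm (z (Suc k) \<omega> - z k \<omega>) = \<bar>step k / n / q ?i\<bar> * norm (U ?i (S (zhat k \<omega>)))"
  proof -
    have "z (Suc k) \<omega> - z k \<omega> = - \<Delta> k ?i \<omega>" using z_Suc[OF assms] by simp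
    then show ?thesis by (simp only: \<Delta>_def norm_minus_cancel norm_scaleR)
  qed
  ultimately show ?thesis using \<open>0 \<le> step k / n / q ?i\<close> by (simp only: abs_of_nonneg)
qed

lemma displacement_tendsto_0:
  assumes "\<omega> \<in> space P" "(\<lambda>k. S (zhat k \<omega>)) \<longlonglongrightarrow> 0"
  shows "(\<lambda>k. z (Suc k) \<omega> - z k \<omega>) \<longlonglongrightarrow> 0"
proof (rule Lim_null_comparison)
  show "\<forall>\<^sub>F k in sequentially. norm (z (Suc k) \<omega> - z k \<omega>) \<le> \<eta>max / n / qmin * norm (S (zhat k \<omega>))"
    by (intro always_eventually allI displacement_le assms(1))
  show "(\<lambda>k. \<eta>max / n / qmin * norm (S (zhat k \<omega>))) \<longlonglongrightarrow> 0"
    by (intro tendsto_mult_right_zero tendsto_norm_zero assms(2))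
qed

text \<open>The set \<open>J\<close> changes with \<open>k\<close>, so its displacements are
  dominated by those of the entire window.\<close>

lemma read_error_tendsto_0:
  assumes \<omega>: "\<omega> \<in> space P" and res: "(\<lambda>k. S (zhat k \<omega>)) \<longlonglongrightarrow> 0"
  shows "(\<lambda>k. zhat k \<omega> - z k \<omega>) \<longlonglongrightarrow> 0"
proof (rule Lim_null_comparison)
  show "(\<lambda>k. \<Sum>d=k - \<tau>..<k. norm (z (Suc d) \<omega> - z d \<omega>)) \<longlonglongrightarrow> 0"
    by (intro window_sum_tendsto_0 tendsto_norm_zero displacement_tendsto_0 assms)
  have "norm (zhat k \<omega> - z k \<omega>) \<le> (\<Sum>d=k - \<tau>..<k. norm (z (Suc d) \<omega> - z d \<omega>))" for k
  proof -
    obtain J where J: "J \<subseteq> {k - \<tau>..<k}" and "zhat k \<omega> = z k \<omega> + (\<Sum>d\<in>J. z d \<omega> - z (Suc d) \<omega>)"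
      using read[OF \<omega>] by blast
    then have "norm (zhat k \<omega> - z k \<omega>) = norm (\<Sum>d\<in>J. z d \<omega> - z (Suc d) \<omega>)" by simp
    also have "\<dots> \<le> (\<Sum>d\<in>J. norm (z d \<omega> - z (Suc d) \<omega>))" by (rule norm_sum)
    also have "\<dots> = (\<Sum>d\<in>J. norm (z (Suc d) \<omega> - z d \<omega>))" by (intro sum.cong refl norm_minus_commute)
    also have "\<dots> \<le> (\<Sum>d=k - \<tau>..<k. norm (z (Suc d) \<omega> - z d \<omega>))"
      using J by (intro sum_mono2) auto
    finally show ?thesis .
  qed
  then show "\<forall>\<^sub>F k in sequentially. norm (zhat k \<omega> - z k \<omega>) \<le> (\<Sum>d=k - \<tau>..<k. norm (z (Suc d) \<omega> - z d \<omega>))"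
    by simp
qed

text \<open>For \<open>d < k\<close> the weights are at most \<tau>, and they vanish below
  \<open>k - \<tau>\<close>; what remains is a window of fixed length.\<close>

lemma lyapunov_tail_tendsto_0:
  assumes "\<omega> \<in> space P" "(\<lambda>k. S (zhat k \<omega>)) \<longlonglongrightarrow> 0"
  shows "(\<lambda>k. \<Sum>d<k. real (d + Suc \<tau> - k) * N (z (Suc d) \<omega> - z d \<omega>)) \<longlonglongrightarrow> 0"
proof (rule Lim_null_comparison)
  let ?D = "\<lambda>d. N (z (Suc d) \<omega> - z d \<omega>)"
  have "?D \<longlonglongrightarrow> 0" using displacement_tendsto_0[OF assms] by (simp add: N_tendsto_0_iff)
  then have "(\<lambda>k. \<Sum>d=k - \<tau>..<k. ?D d) \<longlonglongrightarrow> 0" by (rule window_sum_tendsto_0)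
  then show "(\<lambda>k. \<tau> * (\<Sum>d=k - \<tau>..<k. ?D d)) \<longlonglongrightarrow> 0" by (rule tendsto_mult_right_zero)
  have "norm (\<Sum>d<k. real (d + Suc \<tau> - k) * ?D d) \<le> \<tau> * (\<Sum>d=k - \<tau>..<k. ?D d)" for k
  proof -
    have "0 \<le> (\<Sum>d<k. real (d + Suc \<tau> - k) * ?D d)" by (intro sum_nonneg mult_nonneg_nonneg N_nonneg) simp
    then have "norm (\<Sum>d<k. real (d + Suc \<tau> - k) * ?D d) = (\<Sum>d<k. real (d + Suc \<tau> - k) * ?D d)" by simp
    also have "\<dots> = (\<Sum>d=k - \<tau>..<k. real (d + Suc \<tau> - k) * ?D d)"
      by (rule sum.mono_neutral_right) auto
    also have "\<dots> \<le> (\<Sum>d=k - \<tau>..<k. \<tau> * ?D d)"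
      by (intro sum_mono mult_right_mono N_nonneg) auto
    finally show ?thesis by (simp only: sum_distrib_left)
  qed
  then show "\<forall>\<^sub>F k in sequentially. norm (\<Sum>d<k. real (d + Suc \<tau> - k) * ?D d) \<le> \<tau> * (\<Sum>d=k - \<tau>..<k. ?D d)"
    by simp
qed

lemma AE_residual_tendsto_0: "AE \<omega> in P. (\<lambda>k. S (zhat k \<omega>)) \<longlonglongrightarrow> 0"
proof -
  obtain w where w: "T w = w" using fixed_point_exists by blast
  interpret L: nonneg_supermartingale P F "lyapunov w" "\<lambda>k \<omega>. rate * N (S (zhat k \<omega>))"
    using w by (rule nonneg_supermartingale_lyapunov)
  from L.AE_V_tendsto_0 show ?thesis
  proof (rule AE_mp, intro AE_I2 impI)
    fix \<omega> assume "(\<lambda>k. rate * N (S (zhat k \<omega>))) \<longlonglongrightarrow> 0"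
    then have "(\<lambda>k. 1 / rate * (rate * N (S (zhat k \<omega>)))) \<longlonglongrightarrow> 0" by (rule tendsto_mult_right_zero)
    then show "(\<lambda>k. S (zhat k \<omega>)) \<longlonglongrightarrow> 0" using rate_pos by (simp add: N_tendsto_0_iff)
  qed
qed

text \<open>The distance is the convergent \<open>lyapunov w k\<close> minus a tail that tends to
  zero along with the residual.\<close>

lemma AE_convergent_distance:
  assumes "T w = w"
  shows "AE \<omega> in P. convergent (\<lambda>k. N (z k \<omega> - w))"
proof -
  interpret L: nonneg_supermartingale P F "lyapunov w" "\<lambda>k \<omega>. rate * N (S (zhat k \<omega>))"
    using assms by (rule nonneg_supermartingale_lyapunov)
  from L.AE_convergent AE_residual_tendsto_0 AE_space show ?thesis
  proof eventually_elim
    case (elim \<omega>)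
    have "convergent (\<lambda>k. lyapunov w k \<omega> - c * (\<Sum>d<k. real (d + Suc \<tau> - k) * N (z (Suc d) \<omega> - z d \<omega>)))"
      using elim(1) lyapunov_tail_tendsto_0[OF elim(3,2)]
      by (intro convergent_diff convergent_mult convergent_const) (auto simp: convergent_def)
    then show ?case by (simp add: lyapunov_def)
  qed
qed

lemma AE_converges_to_fixed_point: "AE \<omega> in P. \<exists>l. T l = l \<and> (\<lambda>k. z k \<omega>) \<longlonglongrightarrow> l"
proof -
  \<comment> \<open>The null set in \<open>AE_convergent_distance\<close> depends on
    \<open>w\<close>, so only countably many fixed points can be treated on one almost sure
    event.\<close>
  obtain D where D: "countable D" "D \<subseteq> {w. T w = w}" "{w. T w = w} \<subseteq> closure D"
    using separable[of "{w. T w = w}"] by blast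
  have "D \<noteq> {}" using D(3) fixed_point_exists by auto
  have "AE \<omega> in P. \<forall>w\<in>D. convergent (\<lambda>k. N (z k \<omega> - w))"
    using D(2) AE_convergent_distance by (auto simp: AE_ball_countable[OF D(1)])
  with AE_residual_tendsto_0 AE_space show ?thesis
  proof eventually_elim
    case (elim \<omega>)
    obtain l where "T l = l" "(\<lambda>k. z k \<omega>) \<longlonglongrightarrow> l"
      using Opial[OF \<open>D \<noteq> {}\<close> D(2,3) _ read_error_tendsto_0[OF elim(2,1)] elim(1)] elim(3) by blast
    then show ?case by blast
  qed
qed

lemma converges_to_random_fixed_point:
  "\<exists>X \<in> borel_measurable P. (\<forall>\<omega>\<in>space P. T (X \<omega>) = X \<omega>) \<and> (AE \<omega> in P. (\<lambda>k. z k \<omega>) \<longlonglongrightarrow> X \<omega>)"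
proof -
  obtain w where w: "T w = w" using fixed_point_exists by blast
  define L where "L \<omega> = lim (\<lambda>k. z k \<omega>)" for \<omega>
  \<comment> \<open>\<open>L\<close> is unspecified where the iterates diverge. Falling back on the
    fixed point \<open>w\<close> unless \<open>L \<omega>\<close> is itself fixed makes
    \<open>X\<close> solution-valued at every outcome, and the test is measurable because
    \<open>S\<close> is.\<close>
  define X where "X \<omega> = (if S (L \<omega>) = 0 then L \<omega> else w)" for \<omega>
  have [measurable]: "L \<in> borel_measurable P"
    unfolding L_def by measurable
  have "X \<in> borel_measurable P" unfolding X_def by measurable
  moreover have "T (X \<omega>) = X \<omega>" for \<omega> using w by (auto simp: X_def S_def)
  moreover from AE_converges_to_fixed_point have "AE \<omega> in P. (\<lambda>k. z k \<omega>) \<longlonglongrightarrow> X \<omega>"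
  proof (rule AE_mp, intro AE_I2 impI)
    fix \<omega> assume "\<exists>l. T l = l \<and> (\<lambda>k. z k \<omega>) \<longlonglongrightarrow> l"
    then obtain l where l: "T l = l" "(\<lambda>k. z k \<omega>) \<longlonglongrightarrow> l" by blast
    then have "L \<omega> = l" unfolding L_def by (intro limI)
    then show "(\<lambda>k. z k \<omega>) \<longlonglongrightarrow> X \<omega>" using l by (simp add: X_def S_def)
  qed
  ultimately show ?thesis by blast
qed

end

section \<open>Convergence of the two algorithms\<close>

text \<open>Times \<open>d < 0\<close> contribute nothing, since \<open>nat\<close> sends both
  \<open>d\<close> and \<open>d + 1\<close> to 0; this includes the boundary case
  \<open>d = -1\<close>.\<close>

lemma read_model_imp_nat_window:
  assumes "read_model \<tau> zhat z"
  shows "\<exists>J\<subseteq>{k - \<tau>..<k}. zhat k = z k + (\<Sum>d\<in>J. z d - z (Suc d))"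
proof -
  obtain J where J: "J \<subseteq> {int k - int \<tau> .. int k - 1}"
    and eq: "zhat k = z k + (\<Sum>d\<in>J. z (nat d) - z (nat (d + 1)))"
    using assms by (auto simp: read_model_def)
  let ?K = "{d \<in> J. 0 \<le> d}"
  have "(\<Sum>d\<in>J. z (nat d) - z (nat (d + 1))) = (\<Sum>d\<in>?K. z (nat d) - z (nat (d + 1)))"
  proof (rule sum.mono_neutral_right)
    show "finite J" by (rule finite_subset[OF J]) simp
    show "\<forall>d\<in>J - ?K. z (nat d) - z (nat (d + 1)) = 0"
    proof
      fix d assume "d \<in> J - ?K"
      then have "d < 0" by auto
      then have "nat d = nat (d + 1)" by simp
      then show "z (nat d) - z (nat (d + 1)) = 0" by simp
    qed
  qed auto
  also have "\<dots> = (\<Sum>d\<in>?K. z (nat d) - z (Suc (nat d)))"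
    by (intro sum.cong refl) (auto simp: nat_add_distrib)
  also have "\<dots> = (\<Sum>d\<in>nat ` ?K. z d - z (Suc d))"
    by (subst sum.reindex) (auto simp: inj_on_def)
  finally have "zhat k = z k + (\<Sum>d\<in>nat ` ?K. z d - z (Suc d))" using eq by simp
  moreover have "nat ` ?K \<subseteq> {k - \<tau>..<k}" using J by force
  ultimately show ?thesis by blast
qed

text \<open>The case split between the algorithms is confined to this place: coordinate projections
  serve the first, the \<rho>-weighted blocks the second.\<close>

lemma algorithm_update_by_blocks:
  assumes H: "hilbert_product m H" and G: "hilbert_product p G"
    and idx: "\<And>k \<omega>. \<omega> \<in> space P \<Longrightarrow> idx k \<omega> \<in> {1..n}"
    and alg: "(n = m + p \<and>
          (\<forall>\<omega>\<in>space P. algorithm1 m H p G T q step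
             (\<lambda>k. idx k \<omega>) (\<lambda>k. zhat k \<omega>) (\<lambda>k. z k \<omega>))) \<or>
         (n = m \<and> overlapping_setting m H p G g h A \<rho> \<and>
          (\<forall>\<omega>\<in>space P. algorithm2 m H p G A \<rho> T q step
             (\<lambda>k. idx k \<omega>) (\<lambda>k. zhat k \<omega>) (\<lambda>k. z k \<omega>)))"
  obtains U where "block_resolution n U"
    "\<And>k \<omega>. \<omega> \<in> space P \<Longrightarrow> z (Suc k) \<omega> = z k \<omega> -
      (step k / (real n * q (idx k \<omega>))) *\<^sub>R U (idx k \<omega>) (zhat k \<omega> - T (zhat k \<omega>))"
  using alg
proof (elim disjE conjE)
  assume n: "n = m + p" and a1: "\<forall>\<omega>\<in>space P. algorithm1 m H p G T q step
             (\<lambda>k. idx k \<omega>) (\<lambda>k. zhat k \<omega>) (\<lambda>k. z k \<omega>)"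
  show thesis
  proof (rule that)
    show "block_resolution n (zcoord m H p G)" unfolding n by (rule block_resolution_zcoord[OF H G])
    show "z (Suc k) \<omega> = z k \<omega> -
      (step k / (real n * q (idx k \<omega>))) *\<^sub>R zcoord m H p G (idx k \<omega>) (zhat k \<omega> - T (zhat k \<omega>))"
      if \<omega>: "\<omega> \<in> space P" for k \<omega>
      using algorithm1_update[OF H G a1[rule_format, OF \<omega>], of k] idx[OF \<omega>, of k] n by simp
  qed
next
  assume n: "n = m" and s: "overlapping_setting m H p G g h A \<rho>"
    and a2: "\<forall>\<omega>\<in>space P. algorithm2 m H p G A \<rho> T q step
             (\<lambda>k. idx k \<omega>) (\<lambda>k. zhat k \<omega>) (\<lambda>k. z k \<omega>)"
  show thesis
  proof (rule that)
    show "block_resolution n (overlapping_block m p H G A \<rho>)"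
      unfolding n by (rule block_resolution_overlapping[OF H G s])
    show "z (Suc k) \<omega> = z k \<omega> - (step k / (real n * q (idx k \<omega>))) *\<^sub>R
        overlapping_block m p H G A \<rho> (idx k \<omega>) (zhat k \<omega> - T (zhat k \<omega>))"
      if \<omega>: "\<omega> \<in> space P" for k \<omega>
      using algorithm2_update[OF H G a2[rule_format, OF \<omega>], of k] idx[OF \<omega>, of k] n by simp
  qed
qed

theorem theorem1:
  fixes m p n \<tau> :: nat
    and H :: "nat \<Rightarrow> 'h::euclidean_space set"
    and G :: "nat \<Rightarrow> 'g::euclidean_space set"
    and f :: "'h \<Rightarrow> real" and gradf :: "'h \<Rightarrow> 'h"
    and g :: "'h \<Rightarrow> ereal" and h :: "'g \<Rightarrow> ereal"
    and A :: "'h \<Rightarrow> 'g"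
    and \<eta> \<gamma> \<beta> \<eta>min \<eta>max qmin \<kappa> :: real
    and q step :: "nat \<Rightarrow> real" and \<rho> :: "nat \<Rightarrow> nat \<Rightarrow> real"
    and P :: "'w measure"
    and idx :: "nat \<Rightarrow> 'w \<Rightarrow> nat"
    and z0 :: "'h \<times> 'g" and z zhat :: "nat \<Rightarrow> 'w \<Rightarrow> 'h \<times> 'g"
  defines "T \<equiv> T_CV gradf g h A \<eta> \<gamma>"
    and "qmin \<equiv> Min (q ` {1..n})"
    and "\<kappa> \<equiv> condition_number (M_CV A \<eta> \<gamma>)"
  assumes "hilbert_product m H" and "hilbert_product p G" and "linear A"
    and "\<eta> > 0" and "\<gamma> > 0"
    and "positive_definite (M_CV A \<eta> \<gamma>)"
    and "nonexpansive_wrt (M_CV A \<eta> \<gamma>) T"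
    and "Zstar gradf g h A \<noteq> {}"
    and "closed_proper_convex (\<lambda>x. ereal (f x))"
    and "closed_proper_convex g" and "closed_proper_convex (conjugate h)"
    and "\<And>x. GDERIV f x :> gradf x"
    and "\<beta>-lipschitz_on UNIV gradf"
    and "prob_space P"
    and "\<And>i. i \<in> {1..n} \<Longrightarrow> q i > 0" and "(\<Sum>i=1..n. q i) = 1"
    and "random_indices P n q idx zhat"
    and "\<And>\<omega>. \<omega> \<in> space P \<Longrightarrow> z 0 \<omega> = z0"
    and "\<tau> > 0"
    and "\<And>\<omega>. \<omega> \<in> space P \<Longrightarrow> read_model \<tau> (\<lambda>k. zhat k \<omega>) (\<lambda>k. z k \<omega>)"
    and "\<And>\<omega>. \<omega> \<in> space P \<Longrightarrow> bounded_delays m H p G \<tau> (\<lambda>k. zhat k \<omega>) (\<lambda>k. z k \<omega>)"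
    and "0 < \<eta>min" and "\<eta>min \<le> \<eta>max"
    and "\<eta>max < real n * qmin / (2 * real \<tau> * sqrt (\<kappa> * qmin) + \<kappa>)"
    and "\<And>k. step k \<in> {\<eta>min..\<eta>max}"
    and "(n = m + p \<and>
          (\<forall>\<omega>\<in>space P. algorithm1 m H p G T q step
             (\<lambda>k. idx k \<omega>) (\<lambda>k. zhat k \<omega>) (\<lambda>k. z k \<omega>))) \<or>
         (n = m \<and> overlapping_setting m H p G g h A \<rho> \<and>
          (\<forall>\<omega>\<in>space P. algorithm2 m H p G A \<rho> T q step
             (\<lambda>k. idx k \<omega>) (\<lambda>k. zhat k \<omega>) (\<lambda>k. z k \<omega>)))"
  shows "\<exists>X \<in> borel_measurable P.
           (\<forall>\<omega>\<in>space P. X \<omega> \<in> Zstar gradf g h A) \<and>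
           (AE \<omega> in P. (\<lambda>k. z k \<omega>) \<longlonglongrightarrow> X \<omega>)"
proof -
  let ?M = "M_CV A \<eta> \<gamma>"
  interpret M: symmetric_operator ?M by (rule symmetric_operator_M_CV) fact
  have Zstar: "Zstar gradf g h A = {z. T z = z}"
    unfolding T_def by (rule Zstar_eq_fixed_points) fact+
  \<comment> \<open>Probabilities that sum to one need at least one index, so \<open>Min\<close> in
    \<open>qmin\<close> ranges over a nonempty set.\<close>
  have "{1..n} \<noteq> {}" using \<open>(\<Sum>i=1..n. q i) = 1\<close> by (metis sum.empty zero_neq_one)
  have qmin_le: "qmin \<le> q i" if "i \<in> {1..n}" for i
    using that unfolding qmin_def by (intro Min_le) auto
  have qmin_pos: "0 < qmin"
    using \<open>{1..n} \<noteq> {}\<close> \<open>\<And>i. i \<in> {1..n} \<Longrightarrow> q i > 0\<close> unfolding qmin_def by (subst Min_gr_iff) auto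
  have lo_pos: "0 < Min (eigenvalues ?M)"
    using \<open>positive_definite ?M\<close> by (rule M.Min_eigenvalue_pos)
  have nonexp: "(T x - T y) \<bullet> ?M (T x - T y) \<le> (x - y) \<bullet> ?M (x - y)" for x y
    using \<open>nonexpansive_wrt ?M T\<close> unfolding nonexpansive_wrt_def norm_wrt_def
    by (simp only: real_sqrt_le_iff)
  have idx_in: "idx k \<omega> \<in> {1..n}" if "\<omega> \<in> space P" for k \<omega>
    using \<open>random_indices P n q idx zhat\<close> that by (simp add: random_indices_def)
  obtain U where U: "block_resolution n U"
    "\<And>k \<omega>. \<omega> \<in> space P \<Longrightarrow> z (Suc k) \<omega> = z k \<omega> -
      (step k / (real n * q (idx k \<omega>))) *\<^sub>R U (idx k \<omega>) (zhat k \<omega> - T (zhat k \<omega>))"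
    using algorithm_update_by_blocks[where P = P and idx = idx and n = n,
        OF \<open>hilbert_product m H\<close> \<open>hilbert_product p G\<close> idx_in assms(29)] by blast
  \<comment> \<open>With the extreme eigenvalues as \<open>lo\<close> and \<open>hi\<close>, the
    quotient \<open>hi / lo\<close> is \<kappa> and the step size hypothesis takes the form demanded
    by the locale.\<close>
  interpret async_iteration ?M T "Min (eigenvalues ?M)" "Max (eigenvalues ?M)" P n \<tau> U q step qmin
    \<eta>min \<eta>max idx z0 z zhat
  proof (intro async_iteration.intro nonexpansive_operator.intro nonexpansive_operator_axioms.intro
      async_iteration_axioms.intro)
    show "\<exists>w. T w = w" using Zstar \<open>Zstar gradf g h A \<noteq> {}\<close> by blast
    show "\<eta>max < real n * qmin / (2 * real \<tau> * sqrt (Max (eigenvalues ?M) / Min (eigenvalues ?M) * qmin)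
        + Max (eigenvalues ?M) / Min (eigenvalues ?M))"
      using \<open>\<eta>max < real n * qmin / (2 * real \<tau> * sqrt (\<kappa> * qmin) + \<kappa>)\<close>
      by (simp only: \<kappa>_def condition_number_def)
    show "\<exists>J\<subseteq>{k - \<tau>..<k}. zhat k \<omega> = z k \<omega> + (\<Sum>d\<in>J. z d \<omega> - z (Suc d) \<omega>)"
      if "\<omega> \<in> space P" for k \<omega>
      using read_model_imp_nat_window[OF \<open>\<And>\<omega>. \<omega> \<in> space P \<Longrightarrow> read_model \<tau> (\<lambda>k. zhat k \<omega>) (\<lambda>k. z k \<omega>)\<close>[OF that]] .
  qed (fact M.symmetric_operator_axioms lo_pos M.Min_eigenvalue_le M.le_Max_eigenvalue nonexp qmin_le qmin_pos U
      \<open>prob_space P\<close> \<open>(\<Sum>i=1..n. q i) = 1\<close> \<open>random_indices P n q idx zhat\<close> \<open>0 < \<eta>min\<close>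
      \<open>\<And>\<omega>. \<omega> \<in> space P \<Longrightarrow> z 0 \<omega> = z0\<close> \<open>\<And>k. step k \<in> {\<eta>min..\<eta>max}\<close>)+
  show ?thesis unfolding Zstar using converges_to_random_fixed_point by simp
qed

end
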